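(* Let $K$ be a field of characteristic zero and $S=K[x_1,x_2,x_3]$. Let $f_1,f_2,f_3\in S$ be a regular sequence of homogeneous polynomials of given degrees $d_1,d_2,d_3$, and let $I=(f_1,f_2,f_3)$. If $S/I$ has the strong Lefschetz property, then $J=\operatorname{Gin}(I)$ is uniquely determined (by $d_1,d_2,d_3$) and is an almost reverse lexicographic ideal.
   Context: $S/I$ has the strong Lefschetz property (SLP) if there is a linear form $\ell\in S$ such that for all integers $b\geq 1$ and $t\geq 0$ the multiplication map $\ell^b:(S/I)_t\to(S/I)_{t+b}$ is injective or surjective. $\operatorname{Gin}(I)$ is the generic initial ideal of $I$ with respect to the (graded) reverse lexicographic order with $x_1>x_2>x_3$, i.e. the common initial ideal of $\alpha I$ for all $\alpha$ in a nonempty Zariski open subset of $GL_3(K)$ acting by linear changes of coordinates. A monomial ideal $J$ is almost reverse lexicographic if whenever $u$ is a minimal monomial generator of $J$, every monomial of the same degree as $u$ that precedes $u$ (is larger than $u$) in the reverse lexicographic order also belongs to $J$. *)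

theory Defs
  imports
    "HOL-Analysis.Determinants"
    "HOL-Library.Poly_Mapping"
    "HOL-Computational_Algebra.Polynomial"
begin

text \<open>
  The polynomial ring \<open>K[x\<^sub>1,x\<^sub>2,x\<^sub>3]\<close>: an exponent vector is an element of \<open>nat^3\<close>, and
  \<open>Poly_Mapping\<close> supplies the ring structure (convolution product).  Coordinates are always
  addressed as \<open>1\<close>, \<open>2\<close>, \<open>3\<close>; the built-in order of the numeral type \<open>3\<close> (in which
  \<open>3 = 0\<close> is the least element) is never used.
\<close>

type_synonym expo = "nat^3"
type_synonym 'k poly3 = "expo \<Rightarrow>\<^sub>0 'k"

definition monom :: "expo \<Rightarrow> 'k::comm_ring_1 poly3"
  where "monom m = Poly_Mapping.single m 1"

definition const :: "'k::comm_ring_1 \<Rightarrow> 'k poly3"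
  where "const c = Poly_Mapping.single 0 c"

definition var :: "3 \<Rightarrow> 'k::comm_ring_1 poly3"
  where "var i = monom (axis i 1)"

definition deg :: "expo \<Rightarrow> nat"
  where "deg m = (\<Sum>i\<in>UNIV. m $ i)"

text \<open>The homogeneous component \<open>S\<^sub>d\<close>; it contains \<open>0\<close> for every \<open>d\<close>.\<close>

definition homog :: "nat \<Rightarrow> 'k::comm_ring_1 poly3 set"
  where "homog d = {f. \<forall>m\<in>Poly_Mapping.keys f. deg m = d}"

text \<open>
  Ideals of a commutative ring are the submodules of the ring over itself, so
  \<open>ideal.subspace I\<close> says that \<open>I\<close> is an ideal and \<open>ideal.span B\<close> is the ideal generated by \<open>B\<close>.
\<close>

global_interpretation ideal: module "(*) :: 'a::comm_ring_1 \<Rightarrow> 'a \<Rightarrow> 'a"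
  by standard (simp_all add: algebra_simps)

definition regular_sequence :: "'a::comm_ring_1 list \<Rightarrow> bool"
  where "regular_sequence fs \<longleftrightarrow>
    (\<forall>i<length fs. \<forall>g. fs ! i * g \<in> ideal.span (set (take i fs)) \<longrightarrow> g \<in> ideal.span (set (take i fs)))
    \<and> ideal.span (set fs) \<noteq> UNIV"

subsection \<open>Graded quotients and the strong Lefschetz property\<close>

definition cong_rel :: "'a::comm_ring_1 set \<Rightarrow> ('a \<times> 'a) set"
  where "cong_rel I = {(f, g). f - g \<in> I}"

text \<open>\<open>(S/I)\<^sub>t\<close> is the set of those cosets of \<open>I\<close> that have a representative in \<open>S\<^sub>t\<close>.\<close>

definition quot_comp :: "'k::comm_ring_1 poly3 set \<Rightarrow> nat \<Rightarrow> 'k poly3 set set"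
  where "quot_comp I t = homog t // cong_rel I"

text \<open>Multiplication by (the class of) \<open>p\<close> on \<open>S/I\<close>; see \<open>quot_mult_coset\<close> below.\<close>

definition quot_mult :: "'a::comm_ring_1 set \<Rightarrow> 'a \<Rightarrow> 'a set \<Rightarrow> 'a set"
  where "quot_mult I p C = (\<Union>f\<in>C. cong_rel I `` {p * f})"

lemma equiv_cong_rel:
  assumes "ideal.subspace I"
  shows "equiv UNIV (cong_rel I)"
proof (rule equivI)
  show "refl (cong_rel I)"
    using ideal.subspace_0[OF assms] by (auto simp: refl_on_def cong_rel_def)
  show "sym (cong_rel I)"
  proof (rule symI)
    fix f g assume "(f, g) \<in> cong_rel I"
    then have "- (f - g) \<in> I"
      using ideal.subspace_neg[OF assms] by (simp only: cong_rel_def mem_Collect_eq case_prod_conv)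
    then show "(g, f) \<in> cong_rel I"
      by (simp add: cong_rel_def)
  qed
  show "trans (cong_rel I)"
  proof (rule transI)
    fix f g h assume "(f, g) \<in> cong_rel I" "(g, h) \<in> cong_rel I"
    then have "(f - g) + (g - h) \<in> I"
      using ideal.subspace_add[OF assms] by (simp only: cong_rel_def mem_Collect_eq case_prod_conv)
    then show "(f, h) \<in> cong_rel I"
      by (simp add: cong_rel_def)
  qed
qed simp

lemma quot_mult_coset:
  assumes "ideal.subspace I"
  shows "quot_mult I p (cong_rel I `` {f}) = cong_rel I `` {p * f}"
proof -
  have "(\<lambda>f. cong_rel I `` {p * f}) respects cong_rel I"
  proof (rule congruentI)
    fix g h assume "(g, h) \<in> cong_rel I"
    then have "p * (g - h) \<in> I"
      using ideal.subspace_scale[OF assms] by (simp add: cong_rel_def)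
    then have "(p * g, p * h) \<in> cong_rel I"
      by (simp add: cong_rel_def algebra_simps)
    then show "cong_rel I `` {p * g} = cong_rel I `` {p * h}"
      by (rule equiv_class_eq[OF equiv_cong_rel[OF assms]])
  qed
  then show ?thesis
    unfolding quot_mult_def by (rule UN_equiv_class[OF equiv_cong_rel[OF assms]]) simp
qed

definition SLP :: "'k::comm_ring_1 poly3 set \<Rightarrow> bool"
  where "SLP I \<longleftrightarrow> (\<exists>l\<in>homog 1. \<forall>b\<ge>1. \<forall>t.
    inj_on (quot_mult I (l ^ b)) (quot_comp I t) \<or>
    quot_mult I (l ^ b) ` quot_comp I t = quot_comp I (t + b))"

subsection \<open>The reverse lexicographic order and initial ideals\<close>

text \<open>
  \<open>revlex_less u v\<close> means \<open>x\<^sup>u < x\<^sup>v\<close> in the graded reverse lexicographic order with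
  \<open>x\<^sub>1 > x\<^sub>2 > x\<^sub>3\<close>: in equal degree, the last nonzero entry of \<open>v - u\<close> is negative
  (it cannot be the first entry).
\<close>

definition revlex_less :: "expo \<Rightarrow> expo \<Rightarrow> bool"
  where "revlex_less u v \<longleftrightarrow>
    deg u < deg v \<or> deg u = deg v \<and> (v $ 3 < u $ 3 \<or> v $ 3 = u $ 3 \<and> v $ 2 < u $ 2)"

definition is_lead :: "'k::comm_ring_1 poly3 \<Rightarrow> expo \<Rightarrow> bool"
  where "is_lead f m \<longleftrightarrow> m \<in> Poly_Mapping.keys f \<and>
    (\<forall>n\<in>Poly_Mapping.keys f. n \<noteq> m \<longrightarrow> revlex_less n m)"

definition initial_ideal :: "'k::comm_ring_1 poly3 set \<Rightarrow> 'k poly3 set"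
  where "initial_ideal I = ideal.span {monom m | m. \<exists>f\<in>I. is_lead f m}"

subsection \<open>Generic initial ideals\<close>

text \<open>The linear change of coordinates \<open>x\<^sub>j \<mapsto> \<Sum>\<^sub>i A\<^sub>i\<^sub>j x\<^sub>i\<close>.\<close>

definition act :: "'k::comm_ring_1^3^3 \<Rightarrow> 'k poly3 \<Rightarrow> 'k poly3"
  where "act A f = (\<Sum>m\<in>Poly_Mapping.keys f.
    const (Poly_Mapping.lookup f m) * (\<Prod>j\<in>UNIV. (\<Sum>i\<in>UNIV. const (A $ i $ j) * var i) ^ (m $ j)))"

text \<open>
  Polynomials in the nine entries of a matrix have exponents in \<open>nat^3^3\<close>.  The open subsets
  of \<open>GL\<^sub>3(K)\<close> are the complements in \<open>GL\<^sub>3(K)\<close> of common zero sets of such polynomials.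
\<close>

definition eval_entries :: "(nat^3^3 \<Rightarrow>\<^sub>0 'k) \<Rightarrow> 'k::comm_ring_1^3^3 \<Rightarrow> 'k"
  where "eval_entries p A = (\<Sum>M\<in>Poly_Mapping.keys p.
    Poly_Mapping.lookup p M * (\<Prod>i\<in>UNIV. \<Prod>j\<in>UNIV. A $ i $ j ^ (M $ i $ j)))"

definition zariski_open_GL3 :: "('k::comm_ring_1^3^3) set \<Rightarrow> bool"
  where "zariski_open_GL3 U \<longleftrightarrow> (\<exists>P. U = {A. invertible A \<and> (\<exists>p\<in>P. eval_entries p A \<noteq> 0)})"

definition is_Gin :: "'k::comm_ring_1 poly3 set \<Rightarrow> 'k poly3 set \<Rightarrow> bool"
  where "is_Gin I J \<longleftrightarrow>
    (\<exists>U. zariski_open_GL3 U \<and> U \<noteq> {} \<and> (\<forall>A\<in>U. initial_ideal (act A ` I) = J))"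

text \<open>
  Nonempty open subsets of \<open>GL\<^sub>3(K)\<close> meet (restrict to a line through a point of each), so
  an ideal has at most one generic initial ideal.
\<close>

lemma eval_entries_line:
  fixes A B :: "'k::field^3^3"
  shows "\<exists>q. \<forall>t. poly q t = eval_entries p (\<chi> i j. A $ i $ j + t * B $ i $ j)"
  by (rule exI[of _ "\<Sum>M\<in>Poly_Mapping.keys p. Polynomial.smult (Poly_Mapping.lookup p M)
        (\<Prod>i\<in>UNIV. \<Prod>j\<in>UNIV. [:A $ i $ j, B $ i $ j:] ^ (M $ i $ j))"])
     (simp add: eval_entries_def poly_sum poly_prod)

lemma det_line:
  fixes A B :: "'k::field^3^3"
  shows "\<exists>q. \<forall>t. poly q t = det (\<chi> i j. A $ i $ j + t * B $ i $ j)"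
  by (rule exI[of _ "det (\<chi> i j. [:A $ i $ j, B $ i $ j:])"]) (simp add: det_def poly_sum poly_prod)

lemma zariski_open_GL3_meet:
  fixes U V :: "('k::field_char_0^3^3) set"
  assumes "zariski_open_GL3 U" "U \<noteq> {}" "zariski_open_GL3 V" "V \<noteq> {}"
  shows "U \<inter> V \<noteq> {}"
proof -
  obtain P where U: "U = {A. invertible A \<and> (\<exists>p\<in>P. eval_entries p A \<noteq> 0)}"
    using assms(1) by (auto simp: zariski_open_GL3_def)
  obtain Q where V: "V = {A. invertible A \<and> (\<exists>p\<in>Q. eval_entries p A \<noteq> 0)}"
    using assms(3) by (auto simp: zariski_open_GL3_def)
  obtain A p where A: "invertible A" "p \<in> P" "eval_entries p A \<noteq> 0"
    using assms(2) U by blast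
  obtain B q where B: "invertible B" "q \<in> Q" "eval_entries q B \<noteq> 0"
    using assms(4) V by blast
  define L where "L t = (\<chi> i j. A $ i $ j + t * (B - A) $ i $ j)" for t
  have L: "L 0 = A" "L 1 = B"
    by (simp_all add: L_def vec_eq_iff)
  obtain p' where p': "\<And>t. poly p' t = eval_entries p (L t)"
    using eval_entries_line[of p A "B - A"] unfolding L_def by blast
  obtain q' where q': "\<And>t. poly q' t = eval_entries q (L t)"
    using eval_entries_line[of q A "B - A"] unfolding L_def by blast
  obtain r where r: "\<And>t. poly r t = det (L t)"
    using det_line[of A "B - A"] unfolding L_def by blast
  have "poly p' 0 \<noteq> 0" "poly q' 1 \<noteq> 0" "poly r 0 \<noteq> 0"
    using A B by (simp_all add: p' q' r L invertible_det_nz)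
  then have "p' * q' * r \<noteq> 0"
    by auto
  then have "finite {t. poly (p' * q' * r) t = 0}"
    by (rule poly_roots_finite)
  then obtain t where "poly (p' * q' * r) t \<noteq> 0"
    using infinite_UNIV_char_0[where 'a = 'k] by (metis (mono_tags) ex_new_if_finite mem_Collect_eq)
  then have "L t \<in> U" "L t \<in> V"
    using A B by (auto simp: U V p' q' r invertible_det_nz)
  then show ?thesis
    by blast
qed

lemma is_Gin_unique:
  fixes I :: "'k::field_char_0 poly3 set"
  assumes "is_Gin I J" "is_Gin I J'"
  shows "J = J'"
proof -
  obtain U where U: "zariski_open_GL3 U" "U \<noteq> {}" "\<forall>A\<in>U. initial_ideal (act A ` I) = J"
    using assms(1) unfolding is_Gin_def by blast
  obtain V where V: "zariski_open_GL3 V" "V \<noteq> {}" "\<forall>A\<in>V. initial_ideal (act A ` I) = J'"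
    using assms(2) unfolding is_Gin_def by blast
  obtain A where "A \<in> U" "A \<in> V"
    using zariski_open_GL3_meet[OF U(1,2) V(1,2)] by blast
  then show ?thesis
    using U(3) V(3) by metis
qed

definition Gin :: "'k::field_char_0 poly3 set \<Rightarrow> 'k poly3 set"
  where "Gin I = (THE J. is_Gin I J)"

lemma Gin_eqI: "is_Gin I J \<Longrightarrow> Gin I = J"
  unfolding Gin_def by (rule the_equality) (simp_all add: is_Gin_unique)

subsection \<open>Almost reverse lexicographic ideals\<close>

definition monomial_ideal :: "'k::comm_ring_1 poly3 set \<Rightarrow> bool"
  where "monomial_ideal J \<longleftrightarrow> (\<exists>M. J = ideal.span (monom ` M))"

definition min_monomial_gen :: "'k::comm_ring_1 poly3 set \<Rightarrow> expo \<Rightarrow> bool"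
  where "min_monomial_gen J u \<longleftrightarrow> monom u \<in> J \<and>
    (\<forall>v. monom v \<in> J \<and> (monom v :: 'k poly3) dvd monom u \<longrightarrow> v = u)"

definition almost_revlex :: "'k::comm_ring_1 poly3 set \<Rightarrow> bool"
  where "almost_revlex J \<longleftrightarrow> monomial_ideal J \<and>
    (\<forall>u v. min_monomial_gen J u \<and> deg v = deg u \<and> revlex_less u v \<longrightarrow> monom v \<in> J)"

end

theory Submission imports Defs begin

text \<open>
  Write \<open>L(A)\<close> for the set of leading monomials of the ideal \<open>act A ` I\<close>.

  An almost reverse lexicographic monomial ideal is determined by its Hilbert function: in the
  first degree in which two such ideals differ, a monomial that lies only in one of them is a
  minimal generator there and so exceeds every monomial of this degree outside that ideal; this
  applies to both ideals, which is absurd (\<open>almost_revlex_unique\<close>).  The Hilbert function of \<open>I\<close>,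
  hence that of the ideal spanned by \<open>L(A)\<close>, depends on the degrees only
  (\<open>hilb_regular_sequence\<close>) and \<open>I\<close> contains all forms of large degree (\<open>hilb_rec_zero\<close>).  So
  both the existence of the generic initial ideal and its independence of the polynomials follow
  once \<open>L(A)\<close> is known to span an almost reverse lexicographic ideal for all \<open>A\<close> in a nonempty
  open set.

  As this open set take the invertible matrices \<open>A\<close> for which, in each of the finitely many relevant degrees
  \<open>t\<close> and for each set \<open>Q\<close> of monomials of degree \<open>t\<close> that is closed upwards, the number of elements
  of \<open>L(A)\<close> in \<open>Q\<close> is maximal.  This number is the rank of the projection of the degree \<open>t\<close> part of
  \<open>act A ` I\<close> to the monomials in \<open>Q\<close>, so that maximality is an open condition
  (\<open>lead_count_open\<close>, \<open>generic_lead_counts\<close>).  For such an \<open>A\<close> two things hold.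

  \<^item> \<open>L(A)\<close> is closed under the exchange of \<open>x\<^sub>2\<close> for \<open>x\<^sub>1\<close>.  Otherwise the coordinate change
    \<open>x\<^sub>2 \<mapsto> x\<^sub>2 + s x\<^sub>1\<close> with a suitable \<open>s\<close> would increase one of the numbers, since the derivative
    at \<open>s = 0\<close> brings in the exchanged monomial with a nonzero coefficient in characteristic zero
    (\<open>exchange_in_leads\<close>).

  \<^item> For all \<open>b \<ge> 1\<close> and \<open>t\<close>, either \<open>L(A)\<close> contains every monomial of degree \<open>t + b\<close> that is not
    divisible by \<open>x\<^sub>3\<^sup>b\<close>, or the monomials of degree \<open>t + b\<close> in \<open>L(A)\<close> that are divisible by \<open>x\<^sub>3\<^sup>b\<close>
    stay in \<open>L(A)\<close> after division.  If \<open>A\<close> moves a strong Lefschetz element to \<open>x\<^sub>3\<close>, this is the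
    strong Lefschetz property, because a form whose leading monomial is divisible by \<open>x\<^sub>3\<^sup>b\<close> is itself
    divisible by \<open>x\<^sub>3\<^sup>b\<close> (\<open>SLP_lefschetz_x3\<close>).  The monomials not divisible by \<open>x\<^sub>3\<^sup>b\<close> are closed
    upwards, so that maximality carries the property over to all \<open>A\<close> in the open set
    (\<open>lefschetz_x3_transfer\<close>).

  The two properties imply that the ideal is almost reverse lexicographic (\<open>almost_revlexI\<close>).  Let
  \<open>u\<close> be a minimal generator and \<open>v > u\<close> a monomial of the same degree.  If \<open>v\<close> and \<open>u\<close> have the same
  exponent of \<open>x\<^sub>3\<close>, then exchanges lead from \<open>u\<close> to \<open>v\<close>; otherwise there is
  \<open>b \<ge> 1\<close> such that \<open>x\<^sub>3\<^sup>b\<close> divides \<open>u\<close> but not \<open>v\<close>, and then the ideal contains \<open>v\<close>, because the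
  other alternative of the second property contradicts the minimality of \<open>u\<close>.

  Dimensions are counted by leading monomials throughout, and ranks are handled by a
  fraction-free elimination for indexed families.
\<close>

text \<open>As a rewrite rule from left to right, the associative law \<open>a * (b * x) = (a * b) * x\<close>, which the
  interpretation of a ring as a module over itself brings in, undoes the normalisation of
  products.\<close>

declare ideal.scale_scale [simp del]

section \<open>Exponent vectors and the reverse lexicographic order\<close>

lemma expo_eq_iff: "(u :: expo) = v \<longleftrightarrow> u $ 1 = v $ 1 \<and> u $ 2 = v $ 2 \<and> u $ 3 = v $ 3"
  by (simp add: vec_eq_iff forall_3)

lemma deg_eq: "deg u = u $ 1 + u $ 2 + u $ 3"
  by (simp add: deg_def sum_3)

lemma deg_add [simp]: "deg (u + v) = deg u + deg v"
  by (simp add: deg_eq)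

lemma deg_zero [simp]: "deg 0 = 0"
  by (simp add: deg_eq)

lemma axis_components [simp]:
  "axis (1::3) a $ 1 = a" "axis (1::3) a $ 2 = 0" "axis (1::3) a $ 3 = 0"
  "axis (2::3) a $ 1 = 0" "axis (2::3) a $ 2 = a" "axis (2::3) a $ 3 = 0"
  "axis (3::3) a $ 1 = 0" "axis (3::3) a $ 2 = 0" "axis (3::3) a $ 3 = a"
  by (simp_all add: axis_def)

lemma deg_axis [simp]: "deg (axis i a) = a"
  using exhaust_3[of i] by (auto simp: deg_eq)

lemma revlex_less_trans: "revlex_less u v \<Longrightarrow> revlex_less v w \<Longrightarrow> revlex_less u w"
  by (auto simp: revlex_less_def)

lemma revlex_less_asym: "revlex_less u v \<Longrightarrow> \<not> revlex_less v u"
  by (auto simp: revlex_less_def)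

lemma revlex_less_irrefl [simp]: "\<not> revlex_less u u"
  by (auto simp: revlex_less_def)

lemma revlex_less_total: "u \<noteq> v \<Longrightarrow> revlex_less u v \<or> revlex_less v u"
  by (auto simp: revlex_less_def expo_eq_iff deg_eq)

lemma revlex_less_add: "revlex_less u v \<Longrightarrow> revlex_less (u + w) (v + w)"
  by (auto simp: revlex_less_def)

text \<open>The position of \<open>x\<^sup>u\<close> among the monomials of its degree: within one degree the
  reverse lexicographic order is the order of these natural numbers.\<close>

definition idx :: "expo \<Rightarrow> nat"
  where "idx u = (deg u - u $ 3) * (deg u + 1) + (deg u - u $ 2)"

lemma revlex_less_imp_idx_less:
  assumes "deg u = deg v" "revlex_less u v"
  shows "idx u < idx v"
proof -
  have le: "u $ 3 \<le> deg u" "u $ 2 \<le> deg u" "v $ 3 \<le> deg u" "v $ 2 \<le> deg u"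
    using assms(1) by (simp_all add: deg_eq)
  consider "v $ 3 < u $ 3" | "v $ 3 = u $ 3" "v $ 2 < u $ 2"
    using assms by (auto simp: revlex_less_def)
  then show ?thesis
  proof cases
    case 1
    then have "Suc (deg u - u $ 3) \<le> deg u - v $ 3"
      using le by linarith
    then have "Suc (deg u - u $ 3) * (deg u + 1) \<le> (deg u - v $ 3) * (deg u + 1)"
      by (rule mult_le_mono1)
    then have "(deg u - u $ 3) * (deg u + 1) + (deg u + 1) \<le> (deg u - v $ 3) * (deg u + 1)"
      by simp
    then have "(deg u - u $ 3) * (deg u + 1) + (deg u - u $ 2)
        < (deg u - v $ 3) * (deg u + 1) + (deg u - v $ 2)"
      by linarith
    then show ?thesis
      by (simp only: idx_def assms(1)[symmetric])
  next
    case 2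
    then show ?thesis
      using le by (simp add: idx_def assms(1)[symmetric])
  qed
qed

lemma idx_less_iff: "deg u = deg v \<Longrightarrow> idx u < idx v \<longleftrightarrow> revlex_less u v"
  by (metis revlex_less_imp_idx_less revlex_less_total less_asym less_irrefl)

lemma revlex_max_exists:
  assumes "finite A" "A \<noteq> {}"
  shows "\<exists>m\<in>A. \<forall>n\<in>A. n \<noteq> m \<longrightarrow> revlex_less n m"
  using assms
proof (induction A rule: finite_ne_induct)
  case (singleton x)
  then show ?case by simp
next
  case (insert x F)
  then obtain m where m: "m \<in> F" "\<forall>n\<in>F. n \<noteq> m \<longrightarrow> revlex_less n m"
    by blast
  show ?case
  proof (cases "revlex_less m x")
    case True
    then show ?thesis
      using m by (metis insert_iff revlex_less_trans)
  next
    case False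
    then have "revlex_less x m"
      using m insert by (metis revlex_less_total)
    then show ?thesis
      using m by (metis insert_iff)
  qed
qed

lemma finite_deg_le: "finite {u. deg u \<le> t}"
proof -
  have "{u. deg u \<le> t} \<subseteq> (\<lambda>(a, b, c). vector [a, b, c]) ` ({..t} \<times> {..t} \<times> {..t})"
  proof
    fix u assume "u \<in> {u. deg u \<le> t}"
    then have "u = vector [u $ 1, u $ 2, u $ 3]" "(u $ 1, u $ 2, u $ 3) \<in> {..t} \<times> {..t} \<times> {..t}"
      by (auto simp: expo_eq_iff deg_eq)
    then show "u \<in> (\<lambda>(a, b, c). vector [a, b, c]) ` ({..t} \<times> {..t} \<times> {..t})"
      by (metis (mono_tags, lifting) case_prod_conv image_eqI)
  qed
  then show ?thesis
    by (rule finite_subset) simp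
qed

lemma finite_deg_eq [simp]: "finite {u. deg u = t}"
  by (rule finite_subset[OF _ finite_deg_le[of t]]) auto

lemma card_deg_eq: "2 * card {u. deg u = t} = (t + 1) * (t + 2)"
proof -
  have "bij_betw (\<lambda>u. (u $ 1, u $ 2)) {u. deg u = t} (SIGMA a:{..t}. {..t - a})"
    by (rule bij_betw_byWitness[where f' = "\<lambda>(a, b). vector [a, b, t - a - b]"])
       (auto simp: expo_eq_iff deg_eq)
  then have "card {u. deg u = t} = card (SIGMA a:{..t}. {..t - a})"
    by (rule bij_betw_same_card)
  also have "\<dots> = (\<Sum>a\<le>t. t - a + 1)"
    by simp
  also have "\<dots> = (\<Sum>a\<le>t. a + 1)"
    by (rule sum.reindex_bij_witness[of _ "\<lambda>a. t - a" "\<lambda>a. t - a"]) auto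
  also have "2 * \<dots> = (t + 1) * (t + 2)"
    by (induction t) auto
  finally show ?thesis .
qed

section \<open>Linear algebra for finite families\<close>

text \<open>Linear independence of the family \<open>v i\<close>, \<open>i \<in> I\<close>, of functions restricted to \<open>Q\<close>.\<close>

definition indep_family :: "'u set \<Rightarrow> 'i set \<Rightarrow> ('i \<Rightarrow> 'u \<Rightarrow> 'k::field) \<Rightarrow> bool"
  where "indep_family Q I v \<longleftrightarrow>
    (\<forall>c. (\<forall>u\<in>Q. (\<Sum>i\<in>I. c i * v i u) = 0) \<longrightarrow> (\<forall>i\<in>I. c i = 0))"

lemma indep_familyI:
  "(\<And>c i. (\<And>u. u \<in> Q \<Longrightarrow> (\<Sum>i\<in>I. c i * v i u) = 0) \<Longrightarrow> i \<in> I \<Longrightarrow> c i = 0) \<Longrightarrow> indep_family Q I v"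
  by (auto simp: indep_family_def)

lemma indep_familyD:
  "indep_family Q I v \<Longrightarrow> \<forall>u\<in>Q. (\<Sum>i\<in>I. c i * v i u) = 0 \<Longrightarrow> \<forall>i\<in>I. c i = 0"
  unfolding indep_family_def by (drule spec[of _ c]) (drule (1) mp)

text \<open>A pivot step: clearing the coordinate \<open>u\<close> with the help of \<open>v j\<close> does not change
  independence.\<close>

lemma indep_family_pivot:
  fixes v :: "'i \<Rightarrow> 'u \<Rightarrow> 'k::field"
  assumes "finite I" "j \<notin> I" "u \<in> Q" "v j u \<noteq> 0"
  shows "indep_family Q (insert j I) v \<longleftrightarrow>
    indep_family Q I (\<lambda>i w. v j u * v i w - v i u * v j w)"
proof
  assume ind: "indep_family Q (insert j I) v"
  show "indep_family Q I (\<lambda>i w. v j u * v i w - v i u * v j w)"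
  proof (rule indep_familyI)
    fix c i
    assume c: "\<And>w. w \<in> Q \<Longrightarrow> (\<Sum>i\<in>I. c i * (v j u * v i w - v i u * v j w)) = 0" and i: "i \<in> I"
    define c' where "c' i = (if i = j then - (\<Sum>i\<in>I. c i * v i u) else c i * v j u)" for i
    have "(\<Sum>i\<in>insert j I. c' i * v i w) = 0" if "w \<in> Q" for w
    proof -
      have 1: "(\<Sum>i\<in>I. c' i * v i w) = (\<Sum>i\<in>I. c i * v j u * v i w)"
        by (rule sum.cong) (use assms(2) in \<open>auto simp: c'_def\<close>)
      have 2: "c' j * v j w = - (\<Sum>i\<in>I. c i * v i u * v j w)"
        by (simp add: c'_def sum_distrib_right)
      have "(\<Sum>i\<in>insert j I. c' i * v i w) = c' j * v j w + (\<Sum>i\<in>I. c' i * v i w)"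
        by (rule sum.insert[OF assms(1,2)])
      also have "\<dots> = (\<Sum>i\<in>I. c i * v j u * v i w) - (\<Sum>i\<in>I. c i * v i u * v j w)"
        unfolding 1 2 by simp
      also have "\<dots> = (\<Sum>i\<in>I. c i * (v j u * v i w - v i u * v j w))"
        unfolding sum_subtractf[symmetric] by (intro sum.cong refl) (simp add: algebra_simps)
      also have "\<dots> = 0"
        by (rule c[OF that])
      finally show ?thesis .
    qed
    then have "\<forall>u\<in>Q. (\<Sum>i\<in>insert j I. c' i * v i u) = 0"
      by (rule ballI)
    from indep_familyD[OF ind this] have "c' i = 0"
      using i by simp
    then show "c i = 0"
      using i assms by (auto simp: c'_def split: if_splits)
  qed
next
  assume ind: "indep_family Q I (\<lambda>i w. v j u * v i w - v i u * v j w)"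
  show "indep_family Q (insert j I) v"
  proof (rule indep_familyI)
    fix c i
    assume "\<And>w. w \<in> Q \<Longrightarrow> (\<Sum>i\<in>insert j I. c i * v i w) = 0" and i: "i \<in> insert j I"
    then have c: "c j * v j w + (\<Sum>i\<in>I. c i * v i w) = 0" if "w \<in> Q" for w
      using assms(1,2) that by simp
    have "(\<Sum>i\<in>I. c i * (v j u * v i w - v i u * v j w)) = 0" if "w \<in> Q" for w
    proof -
      have "(\<Sum>i\<in>I. c i * (v j u * v i w - v i u * v j w))
          = v j u * (\<Sum>i\<in>I. c i * v i w) - (\<Sum>i\<in>I. c i * v i u) * v j w"
        unfolding sum_distrib_left sum_distrib_right sum_subtractf[symmetric]
        by (intro sum.cong refl) (simp add: algebra_simps)
      also have "\<dots> = v j u * (c j * v j w + (\<Sum>i\<in>I. c i * v i w))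
          - (c j * v j u + (\<Sum>i\<in>I. c i * v i u)) * v j w"
        by (simp add: algebra_simps)
      also have "\<dots> = 0"
        by (simp only: c[OF that] c[OF assms(3)]) simp
      finally show ?thesis .
    qed
    then have "\<forall>w\<in>Q. (\<Sum>i\<in>I. c i * (v j u * v i w - v i u * v j w)) = 0"
      by (rule ballI)
    from indep_familyD[OF ind this] have 0: "\<forall>i\<in>I. c i = 0" .
    then have "c j * v j u = 0"
      using c[OF assms(3)] by simp
    then show "c i = 0"
      using 0 i assms(4) by auto
  qed
qed

lemma indep_family_nonzero:
  fixes v :: "'i \<Rightarrow> 'u \<Rightarrow> 'k::field"
  assumes "indep_family Q (insert j I) v" "finite I" "j \<notin> I"
  shows "\<exists>u\<in>Q. v j u \<noteq> 0"
proof (rule ccontr)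
  assume n: "\<not> ?thesis"
  have "\<forall>u\<in>Q. (\<Sum>i\<in>insert j I. (if i = j then 1 else 0) * v i u) = 0"
    using assms(2,3) n by (auto intro!: sum.neutral)
  from indep_familyD[OF assms(1) this] show False
    by simp
qed

lemma indep_family_card_le:
  fixes v :: "'i \<Rightarrow> 'u \<Rightarrow> 'k::field"
  assumes "finite I" "finite Q" "indep_family Q I v"
  shows "card I \<le> card Q"
  using assms
proof (induction I arbitrary: v Q rule: finite_induct)
  case empty
  then show ?case by simp
next
  case (insert j I)
  obtain u where u: "u \<in> Q" "v j u \<noteq> 0"
    using indep_family_nonzero[OF insert.prems(2) insert.hyps] by blast
  have ind: "indep_family Q I (\<lambda>i w. v j u * v i w - v i u * v j w)"
    using indep_family_pivot[where v = v, OF insert.hyps u] insert.prems(2) by blast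
  have "indep_family (Q - {u}) I (\<lambda>i w. v j u * v i w - v i u * v j w)"
  proof (rule indep_familyI)
    fix c i
    assume c: "\<And>w. w \<in> Q - {u} \<Longrightarrow> (\<Sum>i\<in>I. c i * (v j u * v i w - v i u * v j w)) = 0" and i: "i \<in> I"
    have "\<forall>w\<in>Q. (\<Sum>i\<in>I. c i * (v j u * v i w - v i u * v j w)) = 0"
    proof
      fix w assume "w \<in> Q"
      then show "(\<Sum>i\<in>I. c i * (v j u * v i w - v i u * v j w)) = 0"
        using c[of w] by (cases "w = u") simp_all
    qed
    from indep_familyD[OF ind this] show "c i = 0"
      using i by simp
  qed
  then have "card I \<le> card (Q - {u})"
    using insert.IH insert.prems(1) by blast
  then show ?case
    using u insert.hyps insert.prems(1) by (simp add: card_Diff_singleton) (metis Suc_pred card_gt_0_iff empty_iff Suc_le_mono)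
qed

text \<open>An algebra of \<open>K\<close>-valued functions, playing the role of the regular functions on a
  parameter space.\<close>

locale function_algebra =
  fixes R :: "('x \<Rightarrow> 'k::field) set"
  assumes const_mem: "(\<lambda>x. c) \<in> R"
    and add_mem: "f \<in> R \<Longrightarrow> g \<in> R \<Longrightarrow> (\<lambda>x. f x + g x) \<in> R"
    and mult_mem: "f \<in> R \<Longrightarrow> g \<in> R \<Longrightarrow> (\<lambda>x. f x * g x) \<in> R"
begin

lemma diff_mem: "f \<in> R \<Longrightarrow> g \<in> R \<Longrightarrow> (\<lambda>x. f x - g x) \<in> R"
  using add_mem[OF _ mult_mem[OF const_mem[of "-1"]], of f g] by simp

lemma sum_mem: "(\<And>a. a \<in> A \<Longrightarrow> f a \<in> R) \<Longrightarrow> (\<lambda>x. \<Sum>a\<in>A. f a x) \<in> R"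
  by (induction A rule: infinite_finite_induct) (auto intro: const_mem add_mem)

text \<open>Independence is an open condition: it is preserved where a single regular function,
  the product of the pivots of a fraction-free elimination, does not vanish.\<close>

lemma indep_family_open:
  assumes "finite I" "\<And>i u. i \<in> I \<Longrightarrow> u \<in> Q \<Longrightarrow> a i u \<in> R"
    and "indep_family Q I (\<lambda>i u. a i u x0)"
  shows "\<exists>p\<in>R. p x0 \<noteq> 0 \<and> (\<forall>x. p x \<noteq> 0 \<longrightarrow> indep_family Q I (\<lambda>i u. a i u x))"
  using assms
proof (induction I arbitrary: a rule: finite_induct)
  case empty
  then show ?case
    by (intro bexI[OF _ const_mem[of 1]]) (auto simp: indep_family_def)
next
  case (insert j I)
  obtain u where u: "u \<in> Q" "a j u x0 \<noteq> 0"
    using indep_family_nonzero[OF insert.prems(2) insert.hyps] by blast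
  define b where "b i w = (\<lambda>x. a j u x * a i w x - a i u x * a j w x)" for i w
  have "b i w \<in> R" if "i \<in> I" "w \<in> Q" for i w
    unfolding b_def using insert.prems(1) u that by (intro diff_mem mult_mem) auto
  moreover have "indep_family Q I (\<lambda>i w. b i w x0)"
    unfolding b_def
    using indep_family_pivot[where v = "\<lambda>i u. a i u x0", OF insert.hyps u] insert.prems(2) by blast
  ultimately have "\<exists>p\<in>R. p x0 \<noteq> 0 \<and> (\<forall>x. p x \<noteq> 0 \<longrightarrow> indep_family Q I (\<lambda>i w. b i w x))"
    by (rule insert.IH)
  then obtain p where p: "p \<in> R" "p x0 \<noteq> 0"
      "\<And>x. p x \<noteq> 0 \<Longrightarrow> indep_family Q I (\<lambda>i w. b i w x)"
    by blast
  show ?case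
  proof (intro bexI[of _ "\<lambda>x. p x * a j u x"] conjI allI impI)
    show "(\<lambda>x. p x * a j u x) \<in> R"
      using p insert.prems(1) u by (intro mult_mem) auto
    show "p x0 * a j u x0 \<noteq> 0"
      using p u by simp
    fix x assume x: "p x * a j u x \<noteq> 0"
    then have "indep_family Q I (\<lambda>i w. a j u x * a i w x - a i u x * a j w x)"
      using p(3)[of x] by (simp add: b_def)
    then show "indep_family Q (insert j I) (\<lambda>i u. a i u x)"
      using indep_family_pivot[where v = "\<lambda>i u. a i u x", OF insert.hyps u(1)] x by simp
  qed
qed

end

section \<open>Coefficients, linear forms and monomials\<close>

abbreviation coef :: "('e \<Rightarrow>\<^sub>0 'k::zero) \<Rightarrow> 'e \<Rightarrow> 'k"
  where "coef \<equiv> Poly_Mapping.lookup"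

lemma const_simps:
  "const 0 = (0 :: 'k::comm_ring_1 poly3)" "const 1 = (1 :: 'k poly3)"
  "const (a + b) = const a + (const b :: 'k poly3)" "const (a * b) = const a * (const b :: 'k poly3)"
  "const (- a) = - (const a :: 'k poly3)"
  by (simp_all add: const_def single_add mult_single single_uminus)

lemma const_sum: "const (\<Sum>i\<in>A. f i) = (\<Sum>i\<in>A. const (f i))"
  by (induction A rule: infinite_finite_induct) (simp_all add: const_simps)

lemma const_power: "const (a ^ n) = const a ^ n"
  by (induction n) (simp_all add: const_simps)

lemma monom_zero: "monom 0 = 1"
  by (simp add: monom_def)

lemma monom_add: "monom (u + v) = monom u * monom v"
  by (simp add: monom_def mult_single)

lemma const_times_monom: "const c * monom u = Poly_Mapping.single u c"
  by (simp add: const_def monom_def mult_single)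

lemma poly_mapping_sum_single:
  "(\<Sum>m\<in>Poly_Mapping.keys f. Poly_Mapping.single m (coef f m)) = (f :: 'e \<Rightarrow>\<^sub>0 'k::comm_monoid_add)"
proof (rule poly_mapping_eqI)
  fix k
  have "coef (\<Sum>m\<in>Poly_Mapping.keys f. Poly_Mapping.single m (coef f m)) k
      = (\<Sum>m\<in>Poly_Mapping.keys f. if m = k then coef f m else 0)"
    by (simp add: lookup_sum lookup_single when_def)
  also have "\<dots> = coef f k"
    by (simp add: sum.delta in_keys_iff)
  finally show "coef (\<Sum>m\<in>Poly_Mapping.keys f. Poly_Mapping.single m (coef f m)) k = coef f k" .
qed

lemma poly3_sum_monom: "f = (\<Sum>m\<in>Poly_Mapping.keys f. const (coef f m) * monom m)"
  by (simp add: const_times_monom poly_mapping_sum_single)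

lemma poly_mapping_induct [case_names zero single add]:
  fixes f :: "'e \<Rightarrow>\<^sub>0 'k::comm_monoid_add"
  assumes "P 0" "\<And>m c. P (Poly_Mapping.single m c)" "\<And>f g. P f \<Longrightarrow> P g \<Longrightarrow> P (f + g)"
  shows "P f"
proof -
  have "P (\<Sum>m\<in>M. Poly_Mapping.single m (coef f m))" if "finite M" for M
    using that by (induction M rule: finite_induct) (auto intro: assms)
  from this[OF finite_keys[of f]] show ?thesis
    by (simp only: poly_mapping_sum_single)
qed

lemma lookup_single_times:
  fixes f :: "expo \<Rightarrow>\<^sub>0 'k::comm_ring_1"
  shows "coef (Poly_Mapping.single k c * f) n = (if \<exists>l. n = k + l then c * coef f (n - k) else 0)"
proof (induction f rule: poly_mapping_induct)
  case zero
  then show ?case by simp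
next
  case (single m d)
  have *: "k + l - k = l" for l
    by (simp add: vec_eq_iff)
  have "(\<exists>l. n = k + l) \<and> m = n - k \<longleftrightarrow> k + m = n"
    using * by metis
  then show ?case
    unfolding mult_single lookup_single when_def by (smt (verit) mult_zero_right)
next
  case (add f g)
  then show ?case
    by (simp add: distrib_left lookup_add)
qed

lemma lookup_const_times [simp]: "coef (const c * f) n = c * coef (f :: 'k::comm_ring_1 poly3) n"
  by (simp add: const_def lookup_single_times)

lemma lookup_monom: "coef (monom m) n = (if m = n then 1 else 0)"
  by (simp add: monom_def lookup_single when_def)

lemma keys_monom [simp]: "Poly_Mapping.keys (monom m :: 'k::comm_ring_1 poly3) = {m}"
  by (simp add: monom_def)

lemma lookup_monom_times_add [simp]: "coef (monom k * f) (k + l) = coef f l"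
proof -
  have "k + l - k = l"
    by (simp add: vec_eq_iff)
  then show ?thesis
    unfolding monom_def by (subst lookup_single_times) auto
qed

lemma keys_monom_times: "Poly_Mapping.keys (monom k * f) = (+) k ` Poly_Mapping.keys (f :: 'k::comm_ring_1 poly3)"
proof (intro equalityI subsetI)
  fix n assume "n \<in> Poly_Mapping.keys (monom k * f)"
  moreover have "k + l - k = l" for l
    by (simp add: vec_eq_iff)
  ultimately show "n \<in> (+) k ` Poly_Mapping.keys f"
    unfolding monom_def in_keys_iff by (subst (asm) lookup_single_times) (auto simp: in_keys_iff split: if_splits)
next
  fix n assume "n \<in> (+) k ` Poly_Mapping.keys f"
  then show "n \<in> Poly_Mapping.keys (monom k * f)"
    by (auto simp: in_keys_iff)
qed

text \<open>The polynomial ring as a module over the coefficients: \<open>kvec.subspace\<close> is the notion of a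
  linear subspace.\<close>

interpretation kvec: module "\<lambda>c (f :: 'k::comm_ring_1 poly3). const c * f"
  by standard (simp_all add: const_simps algebra_simps)

declare kvec.scale_scale [simp del]

lemma kvec_subspace_ideal: "ideal.subspace I \<Longrightarrow> kvec.subspace I"
  unfolding ideal.subspace_def kvec.subspace_def by blast

lemma kvec_subspace_homog: "kvec.subspace (homog t)"
proof (rule kvec.subspaceI)
  fix f g :: "'a poly3" and c
  show "0 \<in> homog t"
    by (simp add: homog_def)
  show "f \<in> homog t \<Longrightarrow> g \<in> homog t \<Longrightarrow> f + g \<in> homog t"
    using keys_add[of f g] by (auto simp: homog_def)
  show "f \<in> homog t \<Longrightarrow> const c * f \<in> homog t"
    by (auto simp: homog_def in_keys_iff)
qed

lemma homog_monom: "monom m \<in> homog t \<longleftrightarrow> deg m = t"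
  by (simp add: homog_def)

lemma homog_mult: "f \<in> homog s \<Longrightarrow> g \<in> homog t \<Longrightarrow> f * g \<in> homog (s + t)"
  using keys_mult[of f g] by (fastforce simp: homog_def)

lemma homog_one: "1 \<in> homog 0"
  by (simp add: homog_def)

lemma homog_power: "f \<in> homog s \<Longrightarrow> f ^ n \<in> homog (n * s)"
  by (induction n) (auto simp: homog_one intro: homog_mult)

lemma homog_const_times: "f \<in> homog t \<Longrightarrow> const c * f \<in> homog t"
  using kvec.subspace_scale[OF kvec_subspace_homog] .

lemma coef_homog: "f \<in> homog t \<Longrightarrow> coef f m \<noteq> 0 \<Longrightarrow> deg m = t"
  by (simp add: homog_def in_keys_iff)

subsection \<open>Homogeneous components\<close>

text \<open>The homogeneous component of degree \<open>t\<close>.\<close>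

definition comp :: "nat \<Rightarrow> 'k::comm_ring_1 poly3 \<Rightarrow> 'k poly3"
  where "comp t f = (\<Sum>m\<in>Poly_Mapping.keys f. if deg m = t then Poly_Mapping.single m (coef f m) else 0)"

lemma lookup_comp: "coef (comp t f) n = (if deg n = t then coef f n else 0)"
proof -
  have "coef (comp t f) n = (\<Sum>m\<in>Poly_Mapping.keys f. if m = n then (if deg n = t then coef f n else 0) else 0)"
    unfolding comp_def lookup_sum by (rule sum.cong) (auto simp: lookup_single when_def)
  also have "\<dots> = (if deg n = t then coef f n else 0)"
    by (simp add: sum.delta in_keys_iff)
  finally show ?thesis .
qed

lemma comp_homog [simp]: "comp t f \<in> homog t"
  by (auto simp: homog_def in_keys_iff lookup_comp split: if_splits)

lemma comp_add: "comp t (f + g) = comp t f + comp t g"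
  by (rule poly_mapping_eqI) (simp add: lookup_comp lookup_add)

lemma comp_sum: "comp t (\<Sum>i\<in>A. f i) = (\<Sum>i\<in>A. comp t (f i))"
  by (rule poly_mapping_eqI) (simp add: lookup_comp lookup_sum)

lemma comp_of_homog: "f \<in> homog s \<Longrightarrow> comp t f = (if s = t then f else 0)"
  by (rule poly_mapping_eqI) (auto simp: lookup_comp homog_def in_keys_iff)

lemma sum_comp: "\<exists>N. f = (\<Sum>s<N. comp s f)"
proof -
  obtain N where N: "\<forall>d\<in>deg ` Poly_Mapping.keys f. d < N"
    by (metis finite_keys finite_imageI finite_nat_set_iff_bounded)
  have "f = (\<Sum>s<N. comp s f)"
  proof (rule poly_mapping_eqI)
    fix n
    have "(\<Sum>s<N. if deg n = s then coef f n else 0) = coef f n"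
      using N by (auto simp: sum.delta in_keys_iff) 
    then show "coef f n = coef (\<Sum>s<N. comp s f) n"
      by (simp add: lookup_sum lookup_comp)
  qed
  then show ?thesis ..
qed

lemma comp_times_homog:
  assumes "f \<in> homog d"
  shows "comp t (g * f) = (if d \<le> t then comp (t - d) g * f else 0)"
proof -
  obtain N where N: "g = (\<Sum>s<N. comp s g)"
    using sum_comp by blast
  have 1: "comp t (comp s g * f) = (if s + d = t then comp s g * f else 0)" for s
    using comp_of_homog[OF homog_mult[OF comp_homog assms]] .
  have "comp t (g * f) = comp t ((\<Sum>s<N. comp s g) * f)"
    by (simp only: N[symmetric])
  also have "\<dots> = (\<Sum>s<N. if s + d = t then comp s g * f else 0)"
    by (simp only: sum_distrib_right comp_sum 1)
  also have "\<dots> = (if d \<le> t then comp (t - d) g * f else 0)"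
  proof (cases "d \<le> t")
    case True
    have "comp (t - d) g = comp (t - d) (\<Sum>s<N. comp s g)"
      by (simp only: N[symmetric])
    also have "\<dots> = (\<Sum>s<N. if s = t - d then comp s g else 0)"
      by (simp only: comp_sum comp_of_homog[OF comp_homog])
    finally have "comp (t - d) g * f = (\<Sum>s<N. (if s = t - d then comp s g else 0) * f)"
      by (simp only: sum_distrib_right)
    then show ?thesis
      using True by (auto intro!: sum.cong)
  qed (auto intro!: sum.neutral)
  finally show ?thesis .
qed

text \<open>A homogeneous ideal: it contains the homogeneous components of its elements.\<close>

definition graded_ideal :: "'k::comm_ring_1 poly3 set \<Rightarrow> bool"
  where "graded_ideal I \<longleftrightarrow> ideal.subspace I \<and> (\<forall>f\<in>I. \<forall>t. comp t f \<in> I)"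

lemma in_ideal_span_insert_iff:
  fixes f :: "'a::comm_ring_1"
  shows "x \<in> ideal.span (insert f X) \<longleftrightarrow> (\<exists>y g. y \<in> ideal.span X \<and> x = y + g * f)"
proof
  assume "x \<in> ideal.span (insert f X)"
  then obtain g where "x - g * f \<in> ideal.span X"
    unfolding ideal.span_insert by blast
  moreover have "x = (x - g * f) + g * f"
    by simp
  ultimately show "\<exists>y g. y \<in> ideal.span X \<and> x = y + g * f"
    by blast
next
  assume "\<exists>y g. y \<in> ideal.span X \<and> x = y + g * f"
  then obtain y g where "y \<in> ideal.span X" "x - g * f = y"
    by auto
  then show "x \<in> ideal.span (insert f X)"
    unfolding ideal.span_insert by blast
qed

lemma graded_ideal_span:
  fixes X :: "'k::comm_ring_1 poly3 set"
  assumes "finite X" "\<And>f. f \<in> X \<Longrightarrow> \<exists>d. f \<in> homog d"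
  shows "graded_ideal (ideal.span X)"
  using assms
proof (induction X rule: finite_induct)
  case empty
  then show ?case
    by (simp add: graded_ideal_def ideal.subspace_0 comp_def ideal.subspace_single_0)
next
  case (insert f X)
  obtain d where d: "f \<in> homog d"
    using insert.prems by blast
  have IH: "graded_ideal (ideal.span X)"
    using insert by blast
  have "comp t x \<in> ideal.span (insert f X)" if "x \<in> ideal.span (insert f X)" for t x
  proof -
    obtain y g where y: "y \<in> ideal.span X" and x: "x = y + g * f"
      using \<open>x \<in> _\<close> by (auto simp: in_ideal_span_insert_iff)
    have "comp t y \<in> ideal.span X"
      using IH y by (simp add: graded_ideal_def)
    moreover have "comp t x = comp t y + (if d \<le> t then comp (t - d) g else 0) * f"
      by (simp add: x comp_add comp_times_homog[OF d])
    ultimately show ?thesis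
      unfolding in_ideal_span_insert_iff by blast
  qed
  then show ?case
    by (simp add: graded_ideal_def)
qed

section \<open>Leading monomials of spaces of forms\<close>

lemma is_lead_exists: "f \<noteq> 0 \<Longrightarrow> \<exists>m. is_lead f m"
  using revlex_max_exists[of "Poly_Mapping.keys f"] by (auto simp: is_lead_def)

lemma is_lead_coef: "is_lead f m \<Longrightarrow> coef f m \<noteq> 0"
  by (simp add: is_lead_def in_keys_iff)

lemma is_lead_greater: "is_lead f m \<Longrightarrow> revlex_less m n \<Longrightarrow> coef f n = 0"
  by (metis in_keys_iff is_lead_def revlex_less_asym revlex_less_irrefl)

lemma is_lead_le: "is_lead f m \<Longrightarrow> coef f n \<noteq> 0 \<Longrightarrow> n \<noteq> m \<Longrightarrow> revlex_less n m"
  by (simp add: is_lead_def in_keys_iff)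

text \<open>The set of leading monomials of the elements of \<open>V\<close>.\<close>

definition leads :: "'k::comm_ring_1 poly3 set \<Rightarrow> expo set"
  where "leads V = {m. \<exists>f\<in>V. is_lead f m}"

lemma leads_deg: "V \<subseteq> homog t \<Longrightarrow> leads V \<subseteq> {u. deg u = t}"
  by (auto simp: leads_def is_lead_def homog_def)

lemma finite_leads: "V \<subseteq> homog t \<Longrightarrow> finite (leads V)"
  by (rule finite_subset[OF leads_deg]) auto

lemma leads_mono: "V \<subseteq> W \<Longrightarrow> leads V \<subseteq> leads W"
  by (auto simp: leads_def)

text \<open>A set of monomials of degree \<open>t\<close> that is closed under passing to larger monomials.\<close>

definition upper_set :: "nat \<Rightarrow> expo set \<Rightarrow> bool"
  where "upper_set t Q \<longleftrightarrow> Q \<subseteq> {u. deg u = t} \<and> (\<forall>u\<in>Q. \<forall>v. deg v = t \<and> revlex_less u v \<longrightarrow> v \<in> Q)"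

lemma upper_set_finite: "upper_set t Q \<Longrightarrow> finite Q"
  unfolding upper_set_def by (metis finite_deg_eq finite_subset)

lemma upper_set_all: "upper_set t {u. deg u = t}"
  by (simp add: upper_set_def)

text \<open>Polynomials with distinct leading monomials are independent, even when only the
  coefficients at these monomials are looked at.\<close>

lemma lead_family_indep:
  fixes f :: "'i \<Rightarrow> 'k::field poly3"
  assumes "finite I" "inj_on m I" "\<And>i. i \<in> I \<Longrightarrow> is_lead (f i) (m i)" "m ` I \<subseteq> Q"
  shows "indep_family Q I (\<lambda>i. coef (f i))"
proof (rule indep_familyI, rule ccontr)
  fix c i
  assume c: "\<And>u. u \<in> Q \<Longrightarrow> (\<Sum>i\<in>I. c i * coef (f i) u) = 0" and i: "i \<in> I" "c i \<noteq> 0"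
  define J where "J = {i\<in>I. c i \<noteq> 0}"
  have "finite (m ` J)" "m ` J \<noteq> {}"
    using assms(1) i by (auto simp: J_def)
  from revlex_max_exists[OF this] obtain j where j: "j \<in> J"
      and max: "\<forall>n\<in>m ` J. n \<noteq> m j \<longrightarrow> revlex_less n (m j)"
    by blast
  have "c i * coef (f i) (m j) = 0" if "i \<in> I - {j}" for i
  proof (cases "c i = 0")
    case False
    then have "m i \<in> m ` J" "m i \<noteq> m j"
      using that j assms(2) by (auto simp: J_def inj_on_def)
    then have "revlex_less (m i) (m j)"
      using max by blast
    then show ?thesis
      using is_lead_greater assms(3) that by (metis DiffD1 mult_zero_right)
  qed simp
  then have "(\<Sum>i\<in>I - {j}. c i * coef (f i) (m j)) = 0"
    by (intro sum.neutral) blast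
  then have "(\<Sum>i\<in>I. c i * coef (f i) (m j)) = c j * coef (f j) (m j)"
    using j assms(1) by (subst sum.remove[of _ j]) (simp_all add: J_def)
  moreover have "m j \<in> Q"
    using j assms(4) by (auto simp: J_def)
  ultimately show False
    using c j is_lead_coef[OF assms(3)] by (auto simp: J_def)
qed

text \<open>For a space \<open>V\<close> of forms, the cardinality of \<open>leads V \<inter> Q\<close> is the dimension of the
  projection of \<open>V\<close> to the monomials in \<open>Q\<close>.  The following half of this statement, and its
  converse \<open>card_leads_le_of_span\<close> for the set \<open>Q\<close> of all monomials of the given degree, replace
  an explicit theory of dimension.\<close>

lemma indep_card_le_leads:
  fixes h :: "'i \<Rightarrow> 'k::field poly3"
  assumes V: "kvec.subspace V" "V \<subseteq> homog t" and Q: "upper_set t Q"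
    and h: "finite I" "\<And>i. i \<in> I \<Longrightarrow> h i \<in> V" "indep_family Q I (\<lambda>i. coef (h i))"
  shows "card I \<le> card (leads V \<inter> Q)"
proof -
  have "indep_family (leads V \<inter> Q) I (\<lambda>i. coef (h i))"
  proof (rule indep_familyI)
    fix c i
    assume c: "\<And>u. u \<in> leads V \<inter> Q \<Longrightarrow> (\<Sum>i\<in>I. c i * coef (h i) u) = 0" and i: "i \<in> I"
    define f where "f = (\<Sum>i\<in>I. const (c i) * h i)"
    have coef_f: "coef f u = (\<Sum>i\<in>I. c i * coef (h i) u)" for u
      by (simp add: f_def lookup_sum)
    have fV: "f \<in> V"
      unfolding f_def using V(1) h(2) by (intro kvec.subspace_sum kvec.subspace_scale)
    have "\<forall>u\<in>Q. (\<Sum>i\<in>I. c i * coef (h i) u) = 0"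
    proof (rule ccontr)
      assume "\<not> ?thesis"
      then obtain u where u: "u \<in> Q" "coef f u \<noteq> 0"
        by (auto simp: coef_f)
      then have "f \<noteq> 0"
        by auto
      then obtain m where m: "is_lead f m"
        using is_lead_exists by blast
      have "deg m = t"
        using coef_homog[OF _ is_lead_coef[OF m]] fV V(2) by blast
      then have "m \<in> Q"
        using Q u is_lead_le[OF m u(2)] unfolding upper_set_def by metis
      then have "coef f m = 0"
        using c m fV by (auto simp: coef_f leads_def)
      then show False
        using is_lead_coef[OF m] by simp
    qed
    from indep_familyD[OF h(3) this] show "c i = 0"
      using i by simp
  qed
  then show ?thesis
    using indep_family_card_le[OF h(1)] finite_leads[OF V(2)] by (metis finite_Int)
qed

text \<open>A chosen element of \<open>V\<close> with leading monomial \<open>u\<close>; it is meaningful only for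
  \<open>u \<in> leads V\<close>.  For a space \<open>V\<close> of forms these elements are a basis of \<open>V\<close>
  (\<open>lead_poly_indep\<close>, \<open>lead_poly_span\<close>).\<close>

definition lead_poly :: "'k::comm_ring_1 poly3 set \<Rightarrow> expo \<Rightarrow> 'k poly3"
  where "lead_poly V u = (SOME f. f \<in> V \<and> is_lead f u)"

lemma lead_poly:
  assumes "u \<in> leads V"
  shows "lead_poly V u \<in> V" "is_lead (lead_poly V u) u"
proof -
  have "\<exists>f. f \<in> V \<and> is_lead f u"
    using assms by (auto simp: leads_def)
  from someI_ex[OF this] show "lead_poly V u \<in> V" "is_lead (lead_poly V u) u"
    by (simp_all add: lead_poly_def)
qed

lemma lead_poly_indep:
  fixes V :: "'k::field poly3 set"
  assumes "finite L" "L \<subseteq> leads V" "L \<subseteq> Q"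
  shows "indep_family Q L (\<lambda>u. coef (lead_poly V u))"
  by (rule lead_family_indep[where m = id]) (use assms lead_poly(2) in auto)

lemma card_leads_le_of_span:
  fixes h :: "'i \<Rightarrow> 'k::field poly3"
  assumes V: "V \<subseteq> homog t"
    and h: "finite I" "\<And>f. f \<in> V \<Longrightarrow> \<exists>a. f = (\<Sum>i\<in>I. const (a i) * h i)"
  shows "card (leads V) \<le> card I"
proof -
  have "\<forall>u\<in>leads V. \<exists>a. lead_poly V u = (\<Sum>i\<in>I. const (a i) * h i)"
    using h(2) lead_poly(1) by metis
  then obtain a where a: "\<And>u. u \<in> leads V \<Longrightarrow> lead_poly V u = (\<Sum>i\<in>I. const (a u i) * h i)"
    by metis
  have ind: "indep_family UNIV (leads V) (\<lambda>u. coef (lead_poly V u))"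
    by (rule lead_poly_indep[OF finite_leads[OF V]]) auto
  have "indep_family I (leads V) a"
  proof (rule indep_familyI)
    fix c w
    assume c: "\<And>i. i \<in> I \<Longrightarrow> (\<Sum>u\<in>leads V. c u * a u i) = 0" and w: "w \<in> leads V"
    have "\<forall>n\<in>UNIV. (\<Sum>u\<in>leads V. c u * coef (lead_poly V u) n) = 0"
    proof
      fix n
      have "(\<Sum>u\<in>leads V. c u * coef (lead_poly V u) n)
          = (\<Sum>u\<in>leads V. \<Sum>i\<in>I. c u * a u i * coef (h i) n)"
        by (intro sum.cong refl) (simp add: a lookup_sum sum_distrib_left mult.assoc)
      also have "\<dots> = (\<Sum>i\<in>I. (\<Sum>u\<in>leads V. c u * a u i) * coef (h i) n)"
        by (subst sum.swap) (simp add: sum_distrib_right)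
      also have "\<dots> = 0"
        by (intro sum.neutral ballI) (simp add: c)
      finally show "(\<Sum>u\<in>leads V. c u * coef (lead_poly V u) n) = 0" .
    qed
    from indep_familyD[OF ind this] show "c w = 0"
      using w by simp
  qed
  then show ?thesis
    by (rule indep_family_card_le[OF finite_leads[OF V] h(1)])
qed

text \<open>Reduction of a form to normal form modulo a space of forms.  The leading monomials of the
  space are cleared in decreasing order, by induction on a bound \<open>N\<close> for the positions of those
  that still occur.\<close>

lemma normal_form_exists:
  fixes V :: "'k::field poly3 set"
  assumes V: "V \<subseteq> homog t" and f: "f \<in> homog t"
  shows "\<exists>c. \<forall>m\<in>leads V. coef (f - (\<Sum>u\<in>leads V. const (c u) * lead_poly V u)) m = 0"
proof -
  define S where "S c = (\<Sum>u\<in>leads V. const (c u) * lead_poly V u)" for c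
  have S_homog: "S c \<in> homog t" for c
    unfolding S_def using V lead_poly(1)[of _ V]
    by (intro kvec.subspace_sum[OF kvec_subspace_homog] homog_const_times) auto
  have "\<exists>c. \<forall>m\<in>leads V. coef (f - S c) m = 0"
    if "\<forall>m\<in>leads V. idx m \<ge> N \<longrightarrow> coef f m = 0" "f \<in> homog t" for N f
    using that
  proof (induction N arbitrary: f)
    case 0
    then show ?case
      by (intro exI[of _ "\<lambda>_. 0"]) (simp add: S_def const_simps)
  next
    case (Suc N)
    show ?case
    proof (cases "\<exists>m\<in>leads V. idx m = N")
      case False
      then have "\<forall>m\<in>leads V. N \<le> idx m \<longrightarrow> coef f m = 0"
        using Suc.prems(1) by (metis Suc_leI le_neq_implies_less)
      then show ?thesis
        using Suc.IH Suc.prems(2) by blast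
    next
      case True
      then obtain m where m: "m \<in> leads V" "idx m = N"
        by blast
      let ?g = "lead_poly V m"
      define a where "a = coef f m / coef ?g m"
      have g: "?g \<in> homog t" "coef ?g m \<noteq> 0"
        using lead_poly[OF m(1)] V is_lead_coef by auto
      have "coef (f - const a * ?g) n = 0" if n: "n \<in> leads V" "N \<le> idx n" for n
      proof (cases "n = m")
        case True
        then show ?thesis
          using g by (simp add: lookup_minus a_def)
      next
        case False
        have d: "deg n = t" "deg m = t"
          using n m leads_deg[OF V] by auto
        have "revlex_less m n"
          using False revlex_less_total[of m n] idx_less_iff[of n m] d m(2) n(2) by auto
        then have "coef ?g n = 0"
          using is_lead_greater lead_poly(2)[OF m(1)] by blast
        moreover have "idx n \<ge> Suc N"
          using idx_less_iff[of m n] d \<open>revlex_less m n\<close> m(2) by simp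
        ultimately show ?thesis
          using Suc.prems(1) n(1) by (simp add: lookup_minus)
      qed
      moreover have "f - const a * ?g \<in> homog t"
        using Suc.prems(2) g(1) by (intro kvec.subspace_diff[OF kvec_subspace_homog] homog_const_times)
      ultimately obtain c where c: "\<forall>m\<in>leads V. coef (f - const a * ?g - S c) m = 0"
        using Suc.IH by blast
      define c' where "c' u = c u + (if u = m then a else 0)" for u
      have "S c' = (\<Sum>u\<in>leads V. const (c u) * lead_poly V u + (if u = m then const a * lead_poly V u else 0))"
        unfolding S_def c'_def by (intro sum.cong refl) (simp add: const_simps distrib_right)
      also have "\<dots> = S c + const a * ?g"
        using m(1) finite_leads[OF V] by (simp add: sum.distrib S_def sum.delta')
      finally have "f - S c' = f - const a * ?g - S c"
        by simp
      then show ?thesis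
        using c by metis
    qed
  qed
  moreover have "\<exists>N. \<forall>m\<in>leads V. idx m < N"
    using finite_nat_set_iff_bounded[of "idx ` leads V"] finite_leads[OF V] by auto
  then obtain N where "\<forall>m\<in>leads V. N \<le> idx m \<longrightarrow> coef f m = 0"
    by (metis not_less)
  ultimately show ?thesis
    using f unfolding S_def by blast
qed

lemma zero_if_no_lead_coef:
  assumes "f \<in> V" "\<And>m. m \<in> leads V \<Longrightarrow> coef f m = 0"
  shows "f = 0"
proof (rule ccontr)
  assume "f \<noteq> 0"
  then obtain m where "is_lead f m"
    using is_lead_exists by blast
  then show False
    using assms is_lead_coef by (auto simp: leads_def)
qed

lemma lead_poly_span:
  fixes V :: "'k::field poly3 set"
  assumes "kvec.subspace V" "V \<subseteq> homog t" "f \<in> V"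
  shows "\<exists>c. f = (\<Sum>u\<in>leads V. const (c u) * lead_poly V u)"
proof -
  obtain c where "\<forall>m\<in>leads V. coef (f - (\<Sum>u\<in>leads V. const (c u) * lead_poly V u)) m = 0"
    using normal_form_exists[OF assms(2)] assms(2,3) by blast
  moreover have "f - (\<Sum>u\<in>leads V. const (c u) * lead_poly V u) \<in> V"
    using assms lead_poly(1)[of _ V]
    by (intro kvec.subspace_diff kvec.subspace_sum kvec.subspace_scale) auto
  ultimately have "f - (\<Sum>u\<in>leads V. const (c u) * lead_poly V u) = 0"
    using zero_if_no_lead_coef by blast
  then show ?thesis
    by auto
qed

lemma card_leads_le_of_injection:
  fixes V W :: "'k::field poly3 set"
  assumes V: "V \<subseteq> homog s" "kvec.subspace V" and W: "kvec.subspace W" "W \<subseteq> homog t"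
    and add: "\<And>f g. \<phi> (f + g) = \<phi> f + \<phi> g" and scale: "\<And>c f. \<phi> (const c * f) = const c * \<phi> f"
    and maps: "\<And>f. f \<in> V \<Longrightarrow> \<phi> f \<in> W" and inj: "\<And>f. f \<in> V \<Longrightarrow> \<phi> f = 0 \<Longrightarrow> f = 0"
  shows "card (leads V) \<le> card (leads W)"
proof -
  have \<phi>0: "\<phi> 0 = 0"
    using scale[of 0 0] by (simp add: const_simps)
  have \<phi>_sum: "\<phi> (\<Sum>i\<in>A. const (c i) * g i) = (\<Sum>i\<in>A. const (c i) * \<phi> (g i))" for c g and A :: "expo set"
    by (induction A rule: infinite_finite_induct) (simp_all add: \<phi>0 add scale)
  have ind: "indep_family UNIV (leads V) (\<lambda>u. coef (lead_poly V u))"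
    by (rule lead_poly_indep[OF finite_leads[OF V(1)]]) auto
  have "card (leads V) \<le> card (leads W \<inter> {u. deg u = t})"
  proof (rule indep_card_le_leads[where h = "\<lambda>u. \<phi> (lead_poly V u)", OF W upper_set_all finite_leads[OF V(1)]])
    show "\<phi> (lead_poly V u) \<in> W" if "u \<in> leads V" for u
      using maps lead_poly(1)[OF that] .
    show "indep_family {u. deg u = t} (leads V) (\<lambda>u. coef (\<phi> (lead_poly V u)))"
    proof (rule indep_familyI)
      fix c w
      assume c: "\<And>n. n \<in> {u. deg u = t} \<Longrightarrow> (\<Sum>u\<in>leads V. c u * coef (\<phi> (lead_poly V u)) n) = 0"
        and w: "w \<in> leads V"
      define f where "f = (\<Sum>u\<in>leads V. const (c u) * lead_poly V u)"
      have f: "f \<in> V"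
        unfolding f_def using V(2) lead_poly(1) by (intro kvec.subspace_sum kvec.subspace_scale)
      have "coef (\<phi> f) n = 0" for n
      proof (cases "deg n = t")
        case True
        then show ?thesis
          using c[of n] by (simp add: f_def \<phi>_sum lookup_sum)
      next
        case False
        then show ?thesis
          using maps[OF f] W(2) coef_homog by blast
      qed
      then have "\<phi> f = 0"
        by (intro poly_mapping_eqI) simp
      then have "f = 0"
        using inj f by blast
      moreover have "coef f n = (\<Sum>u\<in>leads V. c u * coef (lead_poly V u) n)" for n
        by (simp add: f_def lookup_sum)
      ultimately have "\<forall>n\<in>UNIV. (\<Sum>u\<in>leads V. c u * coef (lead_poly V u) n) = 0"
        by (metis lookup_zero)
      from indep_familyD[OF ind this] show "c w = 0"
        using w by simp
    qed
  qed
  also have "\<dots> \<le> card (leads W)"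
    by (intro card_mono finite_leads[OF W(2)]) auto
  finally show ?thesis .
qed

section \<open>Hilbert functions of ideals generated by regular sequences\<close>

text \<open>The homogeneous part of degree \<open>t\<close> of an ideal.\<close>

definition part :: "'k::comm_ring_1 poly3 set \<Rightarrow> nat \<Rightarrow> 'k poly3 set"
  where "part I t = I \<inter> homog t"

lemma part_homog: "part I t \<subseteq> homog t"
  by (simp add: part_def)

lemma kvec_subspace_part: "ideal.subspace I \<Longrightarrow> kvec.subspace (part I t)"
  unfolding part_def by (intro kvec.subspace_inter kvec_subspace_ideal kvec_subspace_homog)

text \<open>The dimension of \<open>(S/I)\<^sub>t\<close>, as the number of standard monomials (\<open>hilb_eq_card\<close>).  It is an
  integer so that the recursion for regular sequences can subtract.\<close>

definition hilb :: "'k::comm_ring_1 poly3 set \<Rightarrow> nat \<Rightarrow> int"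
  where "hilb I t = int (card {u. deg u = t}) - int (card (leads (part I t)))"

lemma hilb_eq_card: "hilb I t = int (card ({u. deg u = t} - leads (part I t)))"
  unfolding hilb_def
  by (subst card_Diff_subset[OF finite_leads[OF part_homog] leads_deg[OF part_homog]])
    (simp add: of_nat_diff card_mono leads_deg[OF part_homog])

lemma hilb_zero_imp:
  fixes I :: "'k::field poly3 set"
  assumes "ideal.subspace I" "hilb I t = 0"
  shows "homog t \<subseteq> I"
proof
  fix f :: "'k poly3" assume f: "f \<in> homog t"
  have "{u. deg u = t} - leads (part I t) = {}"
    using assms(2) unfolding hilb_eq_card by simp
  then have all: "{u. deg u = t} \<subseteq> leads (part I t)"
    by blast
  obtain c where c: "\<forall>m\<in>leads (part I t). coef (f - (\<Sum>u\<in>leads (part I t). const (c u) * lead_poly (part I t) u)) m = 0"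
    using normal_form_exists[OF part_homog f] by blast
  define g where "g = (\<Sum>u\<in>leads (part I t). const (c u) * lead_poly (part I t) u)"
  have g: "g \<in> part I t"
    unfolding g_def using lead_poly(1)[of _ "part I t"] kvec_subspace_part[OF assms(1)]
    by (intro kvec.subspace_sum kvec.subspace_scale) auto
  then have "f - g \<in> homog t"
    using f by (intro kvec.subspace_diff[OF kvec_subspace_homog]) (auto simp: part_def)
  then have "f - g = 0"
    using c all coef_homog[of "f - g" t] unfolding g_def[symmetric]
    by (intro poly_mapping_eqI) (metis (mono_tags, lifting) lookup_zero mem_Collect_eq subsetD)
  then show "f \<in> I"
    using g by (simp add: part_def)
qed

text \<open>Adding a non-zero-divisor \<open>f\<close> of degree \<open>d\<close> to the ideal: in degree \<open>t\<close> the new ideal has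
  the basis consisting of a basis of the old one and of the products of \<open>f\<close> with the standard
  monomials of degree \<open>t - d\<close>.\<close>

lemma hilb_insert:
  fixes X :: "'k::field poly3 set"
  assumes graded: "graded_ideal (ideal.span X)" and f: "f \<in> homog d"
    and reg: "\<And>g. f * g \<in> ideal.span X \<Longrightarrow> g \<in> ideal.span X"
  shows "hilb (ideal.span (insert f X)) t
    = hilb (ideal.span X) t - (if d \<le> t then hilb (ideal.span X) (t - d) else 0)"
proof -
  let ?I = "ideal.span X" and ?I' = "ideal.span (insert f X)"
  have dec: "\<exists>x g. x \<in> part ?I t \<and> g \<in> homog (t - d) \<and> y = x + g * f \<and> (t < d \<longrightarrow> g = 0)"
    if "y \<in> part ?I' t" for y
  proof -
    obtain x g where x: "x \<in> ?I" "y = x + g * f"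
      using \<open>y \<in> part ?I' t\<close> unfolding part_def Int_iff in_ideal_span_insert_iff by blast
    have "y = comp t y"
      using that by (auto simp: part_def comp_of_homog)
    also have "\<dots> = comp t x + (if d \<le> t then comp (t - d) g else 0) * f"
      by (simp add: x(2) comp_add comp_times_homog[OF f])
    finally have "y = comp t x + (if d \<le> t then comp (t - d) g else 0) * f" .
    moreover have "comp t x \<in> part ?I t"
      using x(1) graded by (simp add: part_def graded_ideal_def)
    ultimately show ?thesis
      by (intro exI[of _ "comp t x"] exI[of _ "if d \<le> t then comp (t - d) g else 0"])
        (auto simp: kvec.subspace_0[OF kvec_subspace_homog])
  qed
  have sub: "?I \<subseteq> ?I'"
    by (rule ideal.span_mono) auto
  show ?thesis
  proof (cases "d \<le> t")
    case False
    have "part ?I' t = part ?I t"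
      using dec False sub by (fastforce simp: part_def)
    then show ?thesis
      using False by (simp add: hilb_def)
  next
    case True
    let ?L = "leads (part ?I t)" and ?L' = "leads (part ?I (t - d))"
    define N where "N = {u. deg u = t - d} - ?L'"
    define h where "h = case_sum (lead_poly (part ?I t)) (\<lambda>w. f * monom w)"
    have fin: "finite ?L" "finite N" "finite ?L'"
      using finite_leads[OF part_homog] by (auto simp: N_def)
    have sum_h: "(\<Sum>i\<in>?L <+> N. F i) = (\<Sum>u\<in>?L. F (Inl u)) + (\<Sum>w\<in>N. F (Inr w))"
      for F :: "expo + expo \<Rightarrow> 'c::comm_monoid_add"
      using fin by (simp add: sum.Plus)
    have subsp: "kvec.subspace (part ?I t)" "kvec.subspace (part ?I (t - d))" "kvec.subspace (part ?I' t)"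
      by (auto intro: kvec_subspace_part)
    have h_mem: "h i \<in> part ?I' t" if "i \<in> ?L <+> N" for i
    proof (cases i)
      case (Inl u)
      then show ?thesis
        using that lead_poly(1)[of u "part ?I t"] sub by (auto simp: h_def part_def)
    next
      case (Inr w)
      then have "f * monom w \<in> homog (d + (t - d))"
        using that f by (intro homog_mult) (auto simp: N_def homog_monom)
      moreover have "f * monom w \<in> ?I'"
        using ideal.span_base[of f "insert f X"] ideal.span_scale[of f _ "monom w"]
        by (simp add: mult.commute)
      ultimately show ?thesis
        using Inr True by (simp add: h_def part_def)
    qed
    have "card (?L <+> N) \<le> card (leads (part ?I' t) \<inter> {u. deg u = t})"
    proof (rule indep_card_le_leads[OF subsp(3) part_homog upper_set_all _ h_mem])
      show "finite (?L <+> N)"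
        using fin by simp
      show "indep_family {u. deg u = t} (?L <+> N) (\<lambda>i. coef (h i))"
      proof (rule indep_familyI)
        fix c i
        assume c: "\<And>u. u \<in> {u. deg u = t} \<Longrightarrow> (\<Sum>i\<in>?L <+> N. c i * coef (h i) u) = 0"
          and i: "i \<in> ?L <+> N"
        define x where "x = (\<Sum>u\<in>?L. const (c (Inl u)) * lead_poly (part ?I t) u)"
        define r where "r = (\<Sum>w\<in>N. const (c (Inr w)) * monom w)"
        have x: "x \<in> part ?I t"
          unfolding x_def using lead_poly(1)[of _ "part ?I t"]
          by (intro kvec.subspace_sum[OF subsp(1)] kvec.subspace_scale[OF subsp(1)]) auto
        have r: "r \<in> homog (t - d)"
          unfolding r_def by (intro kvec.subspace_sum[OF kvec_subspace_homog] homog_const_times)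
            (auto simp: N_def homog_monom)
        have coef_r: "coef r m = (if m \<in> N then c (Inr m) else 0)" for m
          using fin by (simp add: r_def lookup_sum lookup_monom if_distrib[of "(*) _"] cong: if_cong)
        have xr: "x + f * r = (\<Sum>i\<in>?L <+> N. const (c i) * h i)"
          by (simp add: sum_h h_def x_def r_def sum_distrib_left mult.left_commute)
        have "coef (x + f * r) n = 0" for n
        proof (cases "deg n = t")
          case True
          then show ?thesis
            using c[of n] by (simp add: xr lookup_sum)
        next
          case False
          have "x + f * r \<in> homog (d + (t - d))"
            using x f r \<open>d \<le> t\<close>
            by (intro kvec.subspace_add[OF kvec_subspace_homog] homog_mult) (auto simp: part_def)
          then show ?thesis
            using False \<open>d \<le> t\<close> coef_homog by fastforce
        qed
        then have 0: "x + f * r = 0"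
          by (intro poly_mapping_eqI) simp
        then have "f * r = - x"
          by (simp add: add_eq_0_iff)
        then have "f * r \<in> ?I"
          using x ideal.span_neg[of x X] by (simp add: part_def)
        then have "r \<in> part ?I (t - d)"
          using reg r by (simp add: part_def)
        then have "r = 0"
          by (rule zero_if_no_lead_coef) (simp add: coef_r N_def)
        then have cr: "c (Inr w) = 0" if "w \<in> N" for w
          using coef_r[of w] that by simp
        have "x = 0"
          using 0 \<open>r = 0\<close> by simp
        then have "\<forall>n\<in>UNIV. (\<Sum>u\<in>?L. c (Inl u) * coef (lead_poly (part ?I t) u) n) = 0"
          unfolding x_def by (metis (mono_tags, lifting) lookup_const_times lookup_sum lookup_zero sum.cong)
        moreover have "indep_family UNIV ?L (\<lambda>u. coef (lead_poly (part ?I t) u))"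
          by (rule lead_poly_indep[OF fin(1)]) auto
        ultimately have "\<forall>u\<in>?L. c (Inl u) = 0"
          using indep_familyD[of UNIV ?L "\<lambda>u. coef (lead_poly (part ?I t) u)" "\<lambda>u. c (Inl u)"] by blast
        then show "c i = 0"
          using i cr by auto
      qed
    qed
    also have "\<dots> \<le> card (leads (part ?I' t))"
      by (intro card_mono finite_leads[OF part_homog]) auto
    finally have ge: "card (?L <+> N) \<le> card (leads (part ?I' t))" .
    have le: "card (leads (part ?I' t)) \<le> card (?L <+> N)"
    proof (rule card_leads_le_of_span[OF part_homog, where h = h])
      show "finite (?L <+> N)"
        using fin by simp
      fix y assume "y \<in> part ?I' t"
      then obtain x g where x: "x \<in> part ?I t" "g \<in> homog (t - d)" "y = x + g * f"
        using dec by blast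
      obtain c where c: "\<forall>m\<in>?L'. coef (g - (\<Sum>u\<in>?L'. const (c u) * lead_poly (part ?I (t - d)) u)) m = 0"
        using normal_form_exists[OF part_homog x(2)] by blast
      define z where "z = (\<Sum>u\<in>?L'. const (c u) * lead_poly (part ?I (t - d)) u)"
      have z: "z \<in> part ?I (t - d)"
        unfolding z_def using lead_poly(1)[of _ "part ?I (t - d)"]
        by (intro kvec.subspace_sum[OF subsp(2)] kvec.subspace_scale[OF subsp(2)]) auto
      have "g - z \<in> homog (t - d)"
        using x(2) z by (intro kvec.subspace_diff[OF kvec_subspace_homog]) (auto simp: part_def)
      then have gz: "coef (g - z) m = 0" if "m \<notin> N" for m
        using that c coef_homog unfolding z_def[symmetric] N_def by blast
      have gz_sum: "g - z = (\<Sum>w\<in>N. const (coef (g - z) w) * monom w)"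
      proof (rule poly_mapping_eqI)
        fix m
        show "coef (g - z) m = coef (\<Sum>w\<in>N. const (coef (g - z) w) * monom w) m"
          using fin gz[of m] by (simp add: lookup_sum lookup_monom if_distrib[of "(*) _"] cong: if_cong)
      qed
      have "f * z \<in> homog (d + (t - d))" "f * z \<in> ?I"
        using z f ideal.span_scale[of z X f] by (auto simp: part_def intro: homog_mult)
      then have "x + f * z \<in> part ?I t"
        using x(1) True by (intro kvec.subspace_add[OF subsp(1)]) (auto simp: part_def)
      then obtain e where e: "x + f * z = (\<Sum>u\<in>?L. const (e u) * lead_poly (part ?I t) u)"
        using lead_poly_span[OF subsp(1) part_homog] by blast
      have "y = (x + f * z) + f * (g - z)"
        by (simp add: x(3) algebra_simps)
      also have "f * (g - z) = (\<Sum>w\<in>N. const (coef (g - z) w) * (f * monom w))"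
        by (subst gz_sum) (simp add: sum_distrib_left mult.left_commute)
      finally have "y = (\<Sum>i\<in>?L <+> N. const (case_sum e (coef (g - z)) i) * h i)"
        by (simp add: e sum_h h_def)
      then show "\<exists>a. y = (\<Sum>i\<in>?L <+> N. const (a i) * h i)"
        by blast
    qed
    have "card (leads (part ?I' t)) = card ?L + card N"
      using le ge fin by (simp add: card_Plus)
    then have "hilb ?I' t = hilb ?I t - int (card N)"
      by (simp add: hilb_def)
    moreover have "hilb ?I (t - d) = int (card N)"
      by (simp add: hilb_eq_card N_def)
    ultimately show ?thesis
      using True by simp
  qed
qed

text \<open>The Hilbert function of the quotient by a regular sequence of forms; the list contains the
  degrees of the forms, the last one first.\<close>

fun hilb_rec :: "nat list \<Rightarrow> nat \<Rightarrow> int"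
  where "hilb_rec [] t = int (card {u. deg u = t})"
  | "hilb_rec (d # ds) t = hilb_rec ds t - (if d \<le> t then hilb_rec ds (t - d) else 0)"

lemma hilb_regular_sequence:
  fixes f1 f2 f3 :: "'k::field poly3"
  assumes f: "f1 \<in> homog d1" "f2 \<in> homog d2" "f3 \<in> homog d3"
    and reg: "regular_sequence [f1, f2, f3]"
  shows "hilb (ideal.span {f1, f2, f3}) t = hilb_rec [d3, d2, d1] t"
proof -
  have reg': "\<And>g. f1 * g \<in> ideal.span {} \<Longrightarrow> g \<in> ideal.span {}"
    "\<And>g. f2 * g \<in> ideal.span {f1} \<Longrightarrow> g \<in> ideal.span {f1}"
    "\<And>g. f3 * g \<in> ideal.span {f2, f1} \<Longrightarrow> g \<in> ideal.span {f2, f1}"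
    using reg by (simp_all add: regular_sequence_def All_less_Suc numeral_2_eq_2 insert_commute)
  have gr: "graded_ideal (ideal.span {})" "graded_ideal (ideal.span {f1})" "graded_ideal (ideal.span {f2, f1})"
    using f by (auto intro!: graded_ideal_span simp del: ideal.span_empty)
  have 0: "hilb (ideal.span ({} :: 'k poly3 set)) t = hilb_rec [] t" for t
    by (auto simp: hilb_def leads_def part_def is_lead_def)
  have 1: "hilb (ideal.span {f1}) t = hilb_rec [d1] t" for t
    by (simp only: hilb_insert[OF gr(1) f(1) reg'(1)] 0 hilb_rec.simps)
  have 2: "hilb (ideal.span {f2, f1}) t = hilb_rec [d2, d1] t" for t
    by (simp only: hilb_insert[OF gr(2) f(2) reg'(2)] 1 hilb_rec.simps)
  have "hilb (ideal.span {f3, f2, f1}) t = hilb_rec [d3, d2, d1] t"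
    by (simp only: hilb_insert[OF gr(3) f(3) reg'(3)] 2 hilb_rec.simps)
  then show ?thesis
    by (simp only: insert_commute)
qed

text \<open>From degree \<open>d\<^sub>1 + d\<^sub>2 + d\<^sub>3\<close> on, the value is a third difference of the quadratic polynomial
  \<open>(t + 1) (t + 2) / 2\<close>.\<close>

lemma hilb_rec_zero:
  assumes "d1 + d2 + d3 \<le> t"
  shows "hilb_rec [d3, d2, d1] t = 0"
proof -
  obtain e where t: "t = e + d1 + d2 + d3"
    using assms by (metis add.commute add.assoc le_Suc_ex)
  define s where "s n = int (card {u. deg u = n})" for n
  have s: "2 * s n = (int n + 1) * (int n + 2)" for n
    using arg_cong[OF card_deg_eq[of n], of int] by (simp add: s_def algebra_simps)
  have "hilb_rec [d3, d2, d1] t = s (e + d1 + d2 + d3) - s (e + d2 + d3)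
     - (s (e + d1 + d3) - s (e + d3)) - (s (e + d1 + d2) - s (e + d2) - (s (e + d1) - s e))"
    by (simp add: t s_def add_ac)
  then have "2 * hilb_rec [d3, d2, d1] t = 2 * s (e + d1 + d2 + d3) - 2 * s (e + d2 + d3)
     - (2 * s (e + d1 + d3) - 2 * s (e + d3)) - (2 * s (e + d1 + d2) - 2 * s (e + d2) - (2 * s (e + d1) - 2 * s e))"
    by simp
  also have "\<dots> = 0"
    unfolding s by (simp add: algebra_simps)
  finally show ?thesis
    by simp
qed

section \<open>Linear changes of coordinates\<close>

text \<open>The \<open>c\<close>-linear extension of a map \<open>\<phi>\<close> on monomials.  If \<open>c\<close> is a ring homomorphism and \<open>\<phi>\<close> is
  multiplicative, then it is a ring homomorphism; this covers both \<open>act A\<close> and the evaluation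
  \<open>eval_entries\<close>.\<close>

definition lin_ext :: "('k::comm_ring_1 \<Rightarrow> 'r::comm_ring_1) \<Rightarrow> ('e::comm_monoid_add \<Rightarrow> 'r) \<Rightarrow> ('e \<Rightarrow>\<^sub>0 'k) \<Rightarrow> 'r"
  where "lin_ext c \<phi> f = (\<Sum>m\<in>Poly_Mapping.keys f. c (coef f m) * \<phi> m)"

locale monomial_hom =
  fixes c :: "'k::comm_ring_1 \<Rightarrow> 'r::comm_ring_1" and \<phi> :: "'e::comm_monoid_add \<Rightarrow> 'r"
  assumes c: "c 0 = 0" "c 1 = 1" "c (a + b) = c a + c b" "c (a * b) = c a * c b"
    and \<phi>: "\<phi> 0 = 1" "\<phi> (m + n) = \<phi> m * \<phi> n"
begin

lemma lin_ext_superset: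
  "finite M \<Longrightarrow> Poly_Mapping.keys f \<subseteq> M \<Longrightarrow> lin_ext c \<phi> f = (\<Sum>m\<in>M. c (coef f m) * \<phi> m)"
  unfolding lin_ext_def by (rule sum.mono_neutral_left) (auto simp: in_keys_iff c)

lemma lin_ext_zero [simp]: "lin_ext c \<phi> 0 = 0"
  by (simp add: lin_ext_def)

lemma lin_ext_single: "lin_ext c \<phi> (Poly_Mapping.single m a) = c a * \<phi> m"
  by (auto simp: lin_ext_def c)

lemma lin_ext_add: "lin_ext c \<phi> (f + g) = lin_ext c \<phi> f + lin_ext c \<phi> g"
proof -
  let ?M = "Poly_Mapping.keys f \<union> Poly_Mapping.keys g"
  have "lin_ext c \<phi> (f + g) = (\<Sum>m\<in>?M. c (coef (f + g) m) * \<phi> m)"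
    by (rule lin_ext_superset) (use keys_add[of f g] in auto)
  also have "\<dots> = (\<Sum>m\<in>?M. c (coef f m) * \<phi> m) + (\<Sum>m\<in>?M. c (coef g m) * \<phi> m)"
    by (simp add: lookup_add c distrib_right sum.distrib)
  also have "\<dots> = lin_ext c \<phi> f + lin_ext c \<phi> g"
    by (simp add: lin_ext_superset[symmetric])
  finally show ?thesis .
qed

lemma lin_ext_mult: "lin_ext c \<phi> (f * g) = lin_ext c \<phi> f * lin_ext c \<phi> g"
proof (induction f rule: poly_mapping_induct)
  case zero
  then show ?case by simp
next
  case (single m a)
  show ?case
  proof (induction g rule: poly_mapping_induct)
    case zero
    then show ?case by simp
  next
    case (single n b)
    then show ?case
      by (simp add: mult_single lin_ext_single c \<phi> mult_ac)
  next
    case (add f g)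
    then show ?case
      by (simp add: distrib_left lin_ext_add)
  qed
next
  case (add f g)
  then show ?case
    by (simp add: distrib_right lin_ext_add)
qed

lemma lin_ext_one: "lin_ext c \<phi> 1 = 1"
  using lin_ext_single[of 0 1] by (simp add: c \<phi>)

lemma lin_ext_sum: "lin_ext c \<phi> (\<Sum>i\<in>A. f i) = (\<Sum>i\<in>A. lin_ext c \<phi> (f i))"
  by (induction A rule: infinite_finite_induct) (simp_all add: lin_ext_add)

lemma lin_ext_prod: "lin_ext c \<phi> (\<Prod>i\<in>A. f i) = (\<Prod>i\<in>A. lin_ext c \<phi> (f i))"
  by (induction A rule: infinite_finite_induct) (simp_all add: lin_ext_mult lin_ext_one)

lemma lin_ext_power: "lin_ext c \<phi> (f ^ n) = lin_ext c \<phi> f ^ n"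
  by (induction n) (simp_all add: lin_ext_mult lin_ext_one)

end

text \<open>The image of the variable \<open>x\<^sub>j\<close> under \<open>act A\<close>.\<close>

definition lin_form :: "'k::comm_ring_1^3^3 \<Rightarrow> 3 \<Rightarrow> 'k poly3"
  where "lin_form A j = (\<Sum>i\<in>UNIV. const (A $ i $ j) * var i)"

text \<open>The image of the monomial \<open>x\<^sup>m\<close> under \<open>act A\<close>.\<close>

definition act_monom :: "'k::comm_ring_1^3^3 \<Rightarrow> expo \<Rightarrow> 'k poly3"
  where "act_monom A m = (\<Prod>j\<in>UNIV. lin_form A j ^ (m $ j))"

lemma act_eq: "act A = lin_ext const (act_monom A)"
  by (simp add: fun_eq_iff act_def lin_ext_def act_monom_def lin_form_def)

interpretation act: monomial_hom const "act_monom A" for A :: "'k::comm_ring_1^3^3"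
  by standard (simp_all add: const_simps act_monom_def power_add prod.distrib)

lemma act_zero: "act A 0 = 0"
  and act_add: "act A (f + g) = act A f + act A g"
  and act_mult: "act A (f * g) = act A f * act A g"
  and act_sum: "act A (\<Sum>i\<in>S. h i) = (\<Sum>i\<in>S. act A (h i))"
  and act_prod: "act A (\<Prod>i\<in>S. h i) = (\<Prod>i\<in>S. act A (h i))"
  and act_power: "act A (f ^ n) = act A f ^ n"
  by (simp_all add: act_eq act.lin_ext_add act.lin_ext_mult act.lin_ext_sum
      act.lin_ext_prod act.lin_ext_power)

lemma act_single: "act A (Poly_Mapping.single m c) = const c * act_monom A m"
  by (simp add: act_eq act.lin_ext_single)

lemma act_const: "act A (const c) = const c"
  using act_single[of A 0 c] by (simp add: const_def act.\<phi>)

lemma act_minus: "act A (f - g) = act A f - act A g"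
  using act_add[of A "f - g" g] by simp

lemma act_monom_eq: "act A (monom m) = act_monom A m"
  by (simp add: monom_def act_single const_simps)

lemma act_var: "act A (var j) = lin_form A j"
proof -
  have "act_monom A (axis j 1) = (\<Prod>i\<in>UNIV. if i = j then lin_form A i else 1)"
    unfolding act_monom_def by (rule prod.cong) (auto simp: axis_def)
  then show ?thesis
    by (simp add: var_def act_monom_eq)
qed

lemma act_monom_prod: "act_monom A m = (\<Prod>j\<in>UNIV. act A (var j) ^ (m $ j))"
  by (simp add: act_monom_def act_var)

lemma act_act: "act A (act B f) = act (A ** B) f"
proof -
  have var: "act A (act B (var j)) = act (A ** B) (var j)" for j
  proof -
    have "act A (act B (var j)) = (\<Sum>i\<in>UNIV. \<Sum>k\<in>UNIV. const (A $ k $ i * B $ i $ j) * var k)"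
      by (simp add: act_var lin_form_def act_sum act_mult act_const sum_distrib_left const_simps mult_ac)
    also have "\<dots> = act (A ** B) (var j)"
      by (subst sum.swap)
        (simp add: act_var lin_form_def matrix_matrix_mult_def const_sum sum_distrib_right)
    finally show ?thesis .
  qed
  show ?thesis
  proof (induction f rule: poly_mapping_induct)
    case (single m c)
    then show ?case
      by (simp add: act_single act_mult act_const act_monom_prod act_prod act_power var)
  qed (simp_all add: act_zero act_add)
qed

lemma prod_UNIV_3: "prod f (UNIV :: 3 set) = f 1 * f 2 * f 3"
  unfolding UNIV_3 by (simp add: ac_simps)

lemma monom_axis_power: "monom (axis j a) ^ n = monom (axis j (n * a))"
proof (induction n)
  case 0
  have "axis j 0 = (0 :: expo)"
    by (simp add: axis_def vec_eq_iff)
  then show ?case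
    by (simp only: power_0 mult_0 monom_zero)
next
  case (Suc n)
  have "axis j a + axis j (n * a) = (axis j (Suc n * a) :: expo)"
    by (simp add: axis_def vec_eq_iff)
  then show ?case
    by (simp add: Suc monom_add[symmetric])
qed

lemma monom_eq_prod_var: "monom m = (\<Prod>j\<in>UNIV. var j ^ (m $ j))"
proof -
  have "m = axis 1 (m $ 1) + axis 2 (m $ 2) + axis 3 (m $ 3)"
    by (simp add: expo_eq_iff)
  then have "monom m = monom (axis 1 (m $ 1) + axis 2 (m $ 2) + axis 3 (m $ 3))"
    by (rule arg_cong)
  then show ?thesis
    by (simp add: prod_UNIV_3 var_def monom_axis_power monom_add)
qed

lemma act_mat_1: "act (mat 1) f = (f :: 'k::comm_ring_1 poly3)"
proof -
  have "lin_form (mat 1 :: 'k^3^3) j = var j" for j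
    using exhaust_3[of j] by (auto simp: lin_form_def mat_def sum_3 const_simps)
  then have "act_monom (mat 1 :: 'k^3^3) m = monom m" for m
    by (simp add: act_monom_def monom_eq_prod_var)
  then have "act (mat 1) (Poly_Mapping.single m c) = Poly_Mapping.single m c" for m and c :: 'k
    by (simp add: act_single const_times_monom)
  then show ?thesis
    by (induction f rule: poly_mapping_induct) (simp_all add: act_zero act_add)
qed

lemma act_inverse:
  assumes "invertible A"
  obtains B where "invertible B" "\<And>f. act B (act A f) = f" "\<And>f. act A (act B f) = f"
  using assms unfolding invertible_def by (metis act_act act_mat_1)

lemma homog_var: "var i \<in> homog 1"
  by (simp add: var_def homog_monom)

lemma homog_lin_form: "lin_form A j \<in> homog 1"
  unfolding lin_form_def
  by (intro kvec.subspace_sum[OF kvec_subspace_homog] homog_const_times homog_var)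

lemma homog_act_monom: "act_monom A m \<in> homog (deg m)"
proof -
  have "lin_form A j ^ (m $ j) \<in> homog (m $ j)" for j
    using homog_power[OF homog_lin_form, of A j "m $ j"] by simp
  then show ?thesis
    unfolding act_monom_def prod_UNIV_3 deg_eq by (intro homog_mult)
qed

lemma homog_act: "f \<in> homog t \<Longrightarrow> act A f \<in> homog t"
  unfolding act_def act_monom_def[unfolded lin_form_def, symmetric]
  using homog_act_monom[of A]
  by (intro kvec.subspace_sum[OF kvec_subspace_homog] homog_const_times) (auto simp: homog_def)

lemma comp_act: "comp t (act A f) = act A (comp t f)"
proof (induction f rule: poly_mapping_induct)
  case zero
  then show ?case
    by (simp add: act_zero comp_def)
next
  case (single m c)
  have h: "Poly_Mapping.single m c \<in> homog (deg m)"
    by (simp add: homog_def)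
  show ?case
    using comp_of_homog[OF h, of t] comp_of_homog[OF homog_act[OF h], of t A] by (simp add: act_zero)
next
  case (add f g)
  then show ?case
    by (simp add: comp_add act_add)
qed

lemma graded_ideal_act:
  assumes "invertible A" "graded_ideal I"
  shows "graded_ideal (act A ` I)"
proof -
  obtain B where B: "\<And>f. act A (act B f) = f"
    using act_inverse[OF assms(1)] by metis
  have I: "ideal.subspace I"
    using assms(2) by (simp add: graded_ideal_def)
  have "ideal.subspace (act A ` I)"
  proof (rule ideal.subspaceI)
    show "0 \<in> act A ` I"
      using ideal.subspace_0[OF I] act_zero by (metis image_eqI)
    fix x y c
    show "x \<in> act A ` I \<Longrightarrow> y \<in> act A ` I \<Longrightarrow> x + y \<in> act A ` I"
      by (auto simp: act_add[symmetric] intro!: imageI ideal.subspace_add[OF I])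
    show "c * x \<in> act A ` I" if x: "x \<in> act A ` I"
    proof -
      obtain f where f: "f \<in> I" "x = act A f"
        using x by blast
      have "c * x = act A (act B c * f)"
        by (simp only: act_mult B f)
      then show ?thesis
        using ideal.subspace_scale[OF I f(1)] by blast
    qed
  qed
  then show ?thesis
    using assms(2) by (auto simp: graded_ideal_def comp_act)
qed

lemma part_act:
  assumes "invertible A"
  shows "part (act A ` I) t = act A ` part I t"
proof -
  obtain B where B: "\<And>f. act B (act A f) = f"
    using act_inverse[OF assms(1)] by metis
  show ?thesis
  proof (intro equalityI subsetI)
    fix g assume "g \<in> part (act A ` I) t"
    then obtain f where f: "f \<in> I" "g = act A f" "g \<in> homog t"
      by (auto simp: part_def)
    then have "f \<in> homog t"
      using homog_act[of g t B] B by simp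
    then show "g \<in> act A ` part I t"
      using f by (simp add: part_def)
  qed (auto simp: part_def intro: homog_act)
qed

lemma card_leads_part_act_le:
  fixes I :: "'k::field poly3 set"
  assumes "invertible A" "graded_ideal I"
  shows "card (leads (part I t)) \<le> card (leads (part (act A ` I) t))"
proof -
  obtain B where B: "\<And>f. act B (act A f) = f"
    using act_inverse[OF assms(1)] by metis
  have sub: "ideal.subspace I" "ideal.subspace (act A ` I)"
    using assms graded_ideal_act[OF assms] by (simp_all add: graded_ideal_def)
  show ?thesis
  proof (rule card_leads_le_of_injection[where \<phi> = "act A", OF part_homog _ _ part_homog])
    show "act A f = 0 \<Longrightarrow> f = 0" for f
      using B[of f] by (simp add: act_zero)
    show "f \<in> part I t \<Longrightarrow> act A f \<in> part (act A ` I) t" for f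
      by (simp add: part_act[OF assms(1)])
  qed (simp_all add: kvec_subspace_part sub act_add act_mult act_const)
qed

lemma card_leads_part_act:
  fixes I :: "'k::field poly3 set"
  assumes "invertible A" "graded_ideal I"
  shows "card (leads (part (act A ` I) t)) = card (leads (part I t))"
proof (rule antisym)
  obtain B where B: "invertible B" "\<And>f. act B (act A f) = f"
    using act_inverse[OF assms(1)] by metis
  have "act B ` act A ` I = I"
    by (simp add: image_image B)
  then show "card (leads (part (act A ` I) t)) \<le> card (leads (part I t))"
    using card_leads_part_act_le[OF B(1) graded_ideal_act[OF assms]] by metis
qed (rule card_leads_part_act_le[OF assms])

section \<open>Regular functions on the space of matrices\<close>

lemma lookup_times_sum:
  fixes f g :: "'k::comm_ring_1 poly3"
  shows "coef (f * g) n = (\<Sum>k | \<exists>l. n = k + l. coef f k * coef g (n - k))"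
proof (induction f rule: poly_mapping_induct)
  case (single m c)
  have fin: "finite {k. \<exists>l. n = k + l}"
    by (rule finite_subset[OF _ finite_deg_le[of "deg n"]]) auto
  have "(\<Sum>k | \<exists>l. n = k + l. coef (Poly_Mapping.single m c) k * coef g (n - k))
      = (\<Sum>k | \<exists>l. n = k + l. if m = k then c * coef g (n - k) else 0)"
    by (rule sum.cong) (auto simp: lookup_single when_def)
  also have "\<dots> = coef (Poly_Mapping.single m c * g) n"
    unfolding lookup_single_times using fin by (simp add: sum.delta')
  finally show ?case ..
qed (simp_all add: distrib_right lookup_add sum.distrib)

lemma (in function_algebra) family_times_mem:
  fixes F G :: "'x \<Rightarrow> 'k poly3"
  assumes "\<And>n. (\<lambda>x. coef (F x) n) \<in> R" "\<And>n. (\<lambda>x. coef (G x) n) \<in> R"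
  shows "(\<lambda>x. coef (F x * G x) n) \<in> R"
  unfolding lookup_times_sum by (intro sum_mem mult_mem assms)

text \<open>The value at \<open>A\<close> of the monomial with exponents \<open>M\<close> in the matrix entries.\<close>

definition entry_monom :: "nat^3^3 \<Rightarrow> 'k::comm_ring_1^3^3 \<Rightarrow> 'k"
  where "entry_monom M A = (\<Prod>i\<in>UNIV. \<Prod>j\<in>UNIV. A $ i $ j ^ (M $ i $ j))"

lemma eval_entries_eq: "eval_entries p A = lin_ext (\<lambda>x. x) (\<lambda>M. entry_monom M A) p"
  by (simp add: eval_entries_def lin_ext_def entry_monom_def)

interpretation eval: monomial_hom "\<lambda>x. x" "\<lambda>M. entry_monom M A" for A :: "'k::comm_ring_1^3^3"
  by standard (simp_all add: entry_monom_def power_add prod.distrib)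

lemma eval_entries_mult: "eval_entries (p * q) A = eval_entries p A * eval_entries q A"
  by (simp add: eval_entries_eq eval.lin_ext_mult)

interpretation entries: function_algebra "range eval_entries :: ('k::field^3^3 \<Rightarrow> 'k) set"
proof
  fix c :: 'k
  have "(\<lambda>A. c) = eval_entries (Poly_Mapping.single 0 c)"
    by (simp add: fun_eq_iff eval_entries_eq eval.lin_ext_single eval.\<phi>)
  then show "(\<lambda>A. c) \<in> range eval_entries"
    by blast
next
  fix f g :: "'k^3^3 \<Rightarrow> 'k"
  assume "f \<in> range eval_entries" "g \<in> range eval_entries"
  then obtain p q where pq: "f = eval_entries p" "g = eval_entries q"
    by blast
  have "(\<lambda>A. f A + g A) = eval_entries (p + q)" "(\<lambda>A. f A * g A) = eval_entries (p * q)"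
    by (simp_all add: fun_eq_iff pq eval_entries_eq eval.lin_ext_add eval.lin_ext_mult)
  then show "(\<lambda>A. f A + g A) \<in> range eval_entries" "(\<lambda>A. f A * g A) \<in> range eval_entries"
    by blast+
qed

lemma entry_mem: "(\<lambda>A. A $ i $ j) \<in> range (eval_entries :: _ \<Rightarrow> 'k::field^3^3 \<Rightarrow> 'k)"
proof -
  have "entry_monom (axis i (axis j 1)) A = A $ i $ j" for A :: "'k^3^3"
  proof -
    have "entry_monom (axis i (axis j 1)) A
        = (\<Prod>k\<in>UNIV. \<Prod>l\<in>UNIV. if k = i \<and> l = j then A $ i $ j else 1)"
      unfolding entry_monom_def by (intro prod.cong refl) (simp add: axis_def)
    also have "\<dots> = (\<Prod>k\<in>UNIV. if k = i then A $ i $ j else 1)"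
      by (intro prod.cong refl) simp
    finally show ?thesis
      by simp
  qed
  then have "(\<lambda>A. A $ i $ j) = (eval_entries (Poly_Mapping.single (axis i (axis j 1)) 1) :: 'k^3^3 \<Rightarrow> 'k)"
    by (simp add: fun_eq_iff eval_entries_eq eval.lin_ext_single)
  then show ?thesis
    by blast
qed

text \<open>The coefficients of \<open>act A f\<close> are polynomials in the entries of \<open>A\<close>.\<close>

lemma act_family_mem: "(\<lambda>A. coef (act A f) n) \<in> range (eval_entries :: _ \<Rightarrow> 'k::field^3^3 \<Rightarrow> 'k)"
proof -
  have lf: "(\<lambda>A. coef (lin_form A j) n) \<in> range (eval_entries :: _ \<Rightarrow> 'k^3^3 \<Rightarrow> 'k)" for j n
    unfolding lin_form_def lookup_sum lookup_const_times
    by (intro entries.sum_mem entries.mult_mem entry_mem entries.const_mem)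
  have pw: "(\<lambda>A. coef (lin_form A j ^ k) n) \<in> range (eval_entries :: _ \<Rightarrow> 'k^3^3 \<Rightarrow> 'k)" for j k n
    by (induction k arbitrary: n)
      (simp_all add: entries.const_mem entries.family_times_mem[OF lf])
  show ?thesis
    unfolding act_eq lin_ext_def act_monom_def prod_UNIV_3 lookup_sum lookup_const_times
    by (intro entries.sum_mem entries.mult_mem entries.const_mem entries.family_times_mem pw)
qed

section \<open>Monomial ideals\<close>

text \<open>A set of monomials that is closed under multiplication by monomials, that is, the set of all
  monomials in a monomial ideal.\<close>

definition up_closed :: "expo set \<Rightarrow> bool"
  where "up_closed L \<longleftrightarrow> (\<forall>u\<in>L. \<forall>w. u + w \<in> L)"

lemma up_closedD: "up_closed L \<Longrightarrow> u \<in> L \<Longrightarrow> u + w \<in> L"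
  by (simp add: up_closed_def)

abbreviation monomial_span :: "expo set \<Rightarrow> 'k::comm_ring_1 poly3 set"
  where "monomial_span L \<equiv> ideal.span (monom ` L)"

lemma monom_in_monomial_span_iff:
  assumes "up_closed L"
  shows "(monom u :: 'k::comm_ring_1 poly3) \<in> monomial_span L \<longleftrightarrow> u \<in> L"
proof
  let ?J = "{f :: 'k poly3. Poly_Mapping.keys f \<subseteq> L}"
  have "ideal.subspace ?J"
  proof (rule ideal.subspaceI)
    fix x y c :: "'k poly3"
    show "0 \<in> ?J"
      by simp
    show "x \<in> ?J \<Longrightarrow> y \<in> ?J \<Longrightarrow> x + y \<in> ?J"
      using keys_add[of x y] by auto
    show "c * x \<in> ?J" if "x \<in> ?J"
      using keys_mult[of c x] that up_closedD[OF assms] by (fastforce simp: add.commute)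
  qed
  then have "monomial_span L \<subseteq> ?J"
    by (intro ideal.span_minimal) auto
  moreover assume "(monom u :: 'k poly3) \<in> monomial_span L"
  ultimately have "Poly_Mapping.keys (monom u :: 'k poly3) \<subseteq> L"
    by blast
  then show "u \<in> L"
    by simp
qed (auto intro: ideal.span_base)

lemma monom_dvd_imp:
  assumes "(monom v :: 'k::comm_ring_1 poly3) dvd monom u"
  shows "\<exists>n. u = v + n"
proof -
  obtain g :: "'k poly3" where "monom u = monom v * g"
    using assms by (elim dvdE)
  then have "u \<in> Poly_Mapping.keys (monom v * g)"
    by (metis keys_monom singletonI)
  then show ?thesis
    unfolding keys_monom_times by auto
qed

lemma min_monomial_genI:
  assumes L: "up_closed L" and u: "u \<in> L" and pred: "\<And>i. u $ i \<ge> 1 \<Longrightarrow> u - axis i 1 \<notin> L"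
  shows "min_monomial_gen (monomial_span L :: 'k::comm_ring_1 poly3 set) u"
proof -
  have "v = u" if v: "v \<in> L" "(monom v :: 'k poly3) dvd monom u" for v
  proof (rule ccontr)
    assume "v \<noteq> u"
    obtain n where n: "u = v + n"
      using monom_dvd_imp v(2) by blast
    then obtain i where i: "n $ i \<noteq> 0"
      using \<open>v \<noteq> u\<close> by (auto simp: vec_eq_iff)
    then have "u - axis i 1 = v + (n - axis i 1)"
      by (auto simp: n vec_eq_iff axis_def)
    moreover have "u $ i \<ge> 1"
      using i n by simp
    ultimately show False
      using pred[of i] up_closedD[OF L v(1)] by metis
  qed
  then show ?thesis
    using u by (simp add: min_monomial_gen_def monom_in_monomial_span_iff[OF L])
qed

text \<open>In the first degree in which two monomial ideals differ, a monomial that lies only in the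
  first one is a minimal generator of it.  If the first ideal is almost reverse lexicographic,
  then this monomial is larger than every monomial of the same degree outside the ideal.\<close>

lemma almost_revlex_difference:
  assumes L: "up_closed L" "almost_revlex (monomial_span L :: 'k::comm_ring_1 poly3 set)"
    and L': "up_closed L'"
    and eq: "\<And>w. deg w < deg u \<Longrightarrow> w \<in> L \<longleftrightarrow> w \<in> L'"
    and u: "u \<in> L" "u \<notin> L'" and v: "deg v = deg u" "v \<notin> L"
  shows "revlex_less v u"
proof -
  have "u - axis i 1 \<notin> L" if i: "u $ i \<ge> 1" for i
  proof
    assume "u - axis i 1 \<in> L"
    moreover have 1: "u = (u - axis i 1) + axis i 1"
      using i by (auto simp: vec_eq_iff axis_def)
    then have "deg u = deg (u - axis i 1) + 1"
      using deg_add[of "u - axis i 1" "axis i 1"] by simp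
    ultimately have "u - axis i 1 \<in> L'"
      using eq by simp
    then show False
      using up_closedD[OF L'] u(2) 1 by metis
  qed
  then have "min_monomial_gen (monomial_span L :: 'k poly3 set) u"
    by (intro min_monomial_genI L(1) u(1))
  then have "\<not> revlex_less u v"
    using L(2) v monom_in_monomial_span_iff[OF L(1), where 'k = 'k] unfolding almost_revlex_def by blast
  then show ?thesis
    using revlex_less_total[of u v] u v by auto
qed

text \<open>An almost reverse lexicographic ideal is determined by its Hilbert function.\<close>

lemma almost_revlex_unique:
  assumes L: "up_closed L" "almost_revlex (monomial_span L :: 'k::comm_ring_1 poly3 set)"
    and L': "up_closed L'" "almost_revlex (monomial_span L' :: 'k poly3 set)"
    and card: "\<And>t. card {u\<in>L. deg u = t} = card {u\<in>L'. deg u = t}"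
  shows "L = L'"
proof -
  have "\<forall>w. deg w = t \<longrightarrow> (w \<in> L \<longleftrightarrow> w \<in> L')" for t
  proof (induction t rule: less_induct)
    case (less t)
    have fin: "finite {u\<in>M. deg u = t}" for M
      by (rule finite_subset[OF _ finite_deg_eq[of t]]) auto
    show ?case
    proof (rule ccontr)
      assume "\<not> ?thesis"
      then have "{u\<in>L. deg u = t} \<noteq> {u\<in>L'. deg u = t}"
        by blast
      then have "\<not> {u\<in>L. deg u = t} \<subseteq> {u\<in>L'. deg u = t}" "\<not> {u\<in>L'. deg u = t} \<subseteq> {u\<in>L. deg u = t}"
        using card_subset_eq[OF fin _ card] card_subset_eq[OF fin _ card[symmetric]] by blast+
      then obtain u v where u: "u \<in> L" "u \<notin> L'" "deg u = t" and v: "v \<in> L'" "v \<notin> L" "deg v = t"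
        by blast
      have "revlex_less v u"
        using less u v by (intro almost_revlex_difference[OF L L'(1)]) auto
      moreover have "revlex_less u v"
        using less u v by (intro almost_revlex_difference[OF L' L(1)]) auto
      ultimately show False
        using revlex_less_asym by blast
    qed
  qed
  then show ?thesis
    by blast
qed

text \<open>Two properties of a monomial ideal that make it almost reverse lexicographic: stability
  under the exchange of \<open>x\<^sub>2\<close> for \<open>x\<^sub>1\<close>, and the strong Lefschetz property with \<open>x\<^sub>3\<close> as the linear
  form.  In the second definition \<open>L\<close> is the set of monomials in the ideal; the two alternatives
  say that multiplication by \<open>x\<^sub>3\<^sup>b\<close> from degree \<open>t\<close> to degree \<open>t + b\<close> of the quotient is
  surjective or injective.\<close>

definition exchange_closed :: "expo set \<Rightarrow> bool"
  where "exchange_closed L \<longleftrightarrow> (\<forall>u\<in>L. u $ 2 \<ge> 1 \<longrightarrow> u + axis 1 1 - axis 2 1 \<in> L)"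

definition lefschetz_x3 :: "expo set \<Rightarrow> bool"
  where "lefschetz_x3 L \<longleftrightarrow> (\<forall>b\<ge>1. \<forall>t.
    (\<forall>n. deg n = t + b \<and> n $ 3 < b \<longrightarrow> n \<in> L) \<or>
    (\<forall>n\<in>L. deg n = t + b \<and> b \<le> n $ 3 \<longrightarrow> n - axis 3 b \<in> L))"

lemma almost_revlexI:
  assumes L: "up_closed L" "exchange_closed L" "lefschetz_x3 L"
  shows "almost_revlex (monomial_span L :: 'k::comm_ring_1 poly3 set)"
  unfolding almost_revlex_def
proof (intro conjI allI impI)
  show "monomial_ideal (monomial_span L :: 'k poly3 set)"
    unfolding monomial_ideal_def by blast
  fix u v
  assume "min_monomial_gen (monomial_span L :: 'k poly3 set) u \<and> deg v = deg u \<and> revlex_less u v"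
  then have u: "u \<in> L" "\<And>w. w \<in> L \<Longrightarrow> (monom w :: 'k poly3) dvd monom u \<Longrightarrow> w = u"
    and deg: "deg v = deg u" and less: "revlex_less u v"
    by (auto simp: min_monomial_gen_def monom_in_monomial_span_iff[OF L(1)])
  have "v \<in> L"
  proof (cases "v $ 3 = u $ 3")
    case True
    have "v \<in> L" if "w \<in> L" "deg v = deg w" "v $ 3 = w $ 3" "w $ 2 = v $ 2 + k" for w k
      using that
    proof (induction k arbitrary: w)
      case 0
      then show ?case
        using expo_eq_iff[of v w] by (simp add: deg_eq)
    next
      case (Suc k)
      show ?case
      proof (rule Suc.IH)
        show "w + axis 1 1 - axis 2 1 \<in> L"
          using L(2) Suc.prems unfolding exchange_closed_def by simp
      qed (use Suc.prems in \<open>simp_all add: deg_eq\<close>)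
    qed
    from this[OF u(1) deg True, of "u $ 2 - v $ 2"] show ?thesis
      using less deg True by (simp add: revlex_less_def)
  next
    case False
    then have 3: "v $ 3 < u $ 3"
      using less deg by (auto simp: revlex_less_def)
    define b where "b = v $ 3 + 1"
    have b: "b \<ge> 1" "deg u = (deg u - b) + b" "b \<le> u $ 3" "v $ 3 < b"
      using 3 by (simp_all add: b_def deg_eq)
    have "u - axis 3 b \<notin> L"
    proof
      assume *: "u - axis 3 b \<in> L"
      have "u = (u - axis 3 b) + axis 3 b"
        using b by (simp add: expo_eq_iff)
      then have "(monom u :: 'k poly3) = monom (u - axis 3 b) * monom (axis 3 b)"
        by (metis monom_add)
      then have "u - axis 3 b = u"
        using u(2)[OF *] by simp
      then have "u $ 3 - b = u $ 3"
        by (metis axis_components(9) vector_minus_component)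
      then show False
        using b by simp
    qed
    then have "\<forall>n. deg n = (deg u - b) + b \<and> n $ 3 < b \<longrightarrow> n \<in> L"
      using L(3) b u(1) unfolding lefschetz_x3_def by metis
    then show ?thesis
      using b deg by metis
  qed
  then show "(monom v :: 'k poly3) \<in> monomial_span L"
    by (simp add: monom_in_monomial_span_iff[OF L(1)])
qed

subsection \<open>Initial ideals\<close>

lemma initial_ideal_eq: "initial_ideal I = monomial_span (leads I)"
  unfolding initial_ideal_def leads_def by (rule arg_cong[of _ _ ideal.span]) blast

lemma is_lead_monom_times:
  fixes f :: "'k::comm_ring_1 poly3"
  assumes "is_lead f m"
  shows "is_lead (monom w * f) (m + w)"
  unfolding is_lead_def
proof (intro conjI ballI impI)
  show "m + w \<in> Poly_Mapping.keys (monom w * f)"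
    using assms unfolding keys_monom_times is_lead_def by (auto simp: add.commute)
  fix n assume "n \<in> Poly_Mapping.keys (monom w * f)" "n \<noteq> m + w"
  then obtain k where k: "n = k + w" "k \<in> Poly_Mapping.keys f" "k \<noteq> m"
    unfolding keys_monom_times by (auto simp: add.commute)
  then show "revlex_less n (m + w)"
    using assms by (simp add: is_lead_def revlex_less_add)
qed

lemma up_closed_leads:
  assumes "ideal.subspace (I :: 'k::comm_ring_1 poly3 set)"
  shows "up_closed (leads I)"
  unfolding up_closed_def leads_def
  using is_lead_monom_times ideal.subspace_scale[OF assms] by blast

text \<open>The leading monomial of a polynomial is that of its homogeneous component of highest
  degree.\<close>

lemma leads_part:
  assumes "graded_ideal (I :: 'k::comm_ring_1 poly3 set)"
  shows "leads (part I t) = {u\<in>leads I. deg u = t}"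
proof (intro equalityI subsetI)
  fix u assume "u \<in> leads (part I t)"
  then show "u \<in> {u\<in>leads I. deg u = t}"
    using leads_deg[OF part_homog] leads_mono[of "part I t" I] by (auto simp: part_def)
next
  fix u assume "u \<in> {u\<in>leads I. deg u = t}"
  then obtain f where f: "f \<in> I" "is_lead f u" "deg u = t"
    by (auto simp: leads_def)
  have "is_lead (comp t f) u"
    using f(2,3) by (auto simp: is_lead_def in_keys_iff lookup_comp split: if_splits)
  moreover have "comp t f \<in> part I t"
    using f(1) assms by (simp add: part_def graded_ideal_def)
  ultimately show "u \<in> leads (part I t)"
    by (auto simp: leads_def)
qed

section \<open>Matrices in general position\<close>

lemma zariski_open_GL3_basic:
  "zariski_open_GL3 {A :: 'k::comm_ring_1^3^3. invertible A \<and> eval_entries p A \<noteq> 0}"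
  unfolding zariski_open_GL3_def by (rule exI[of _ "{p}"]) simp

lemma zariski_open_GL3_Int:
  fixes U V :: "('k::field^3^3) set"
  assumes "zariski_open_GL3 U" "zariski_open_GL3 V"
  shows "zariski_open_GL3 (U \<inter> V)"
proof -
  obtain P Q where U: "U = {A. invertible A \<and> (\<exists>p\<in>P. eval_entries p A \<noteq> 0)}"
    and V: "V = {A. invertible A \<and> (\<exists>p\<in>Q. eval_entries p A \<noteq> 0)}"
    using assms unfolding zariski_open_GL3_def by blast
  have "U \<inter> V = {A. invertible A \<and> (\<exists>r\<in>(\<lambda>(p, q). p * q) ` (P \<times> Q). eval_entries r A \<noteq> 0)}"
    by (auto simp: U V eval_entries_mult)
  then show ?thesis
    unfolding zariski_open_GL3_def by blast
qed

text \<open>The number of leading monomials in \<open>Q\<close> after the change of coordinates \<open>A\<close>.\<close>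

definition lead_count :: "'k::comm_ring_1 poly3 set \<Rightarrow> nat \<Rightarrow> expo set \<Rightarrow> 'k^3^3 \<Rightarrow> nat"
  where "lead_count I T Q A = card (leads (part (act A ` I) T) \<inter> Q)"

lemma lead_count_open:
  fixes I :: "'k::field poly3 set"
  assumes I: "graded_ideal I" and Q: "upper_set T Q" and A0: "invertible A0"
  shows "\<exists>p. eval_entries p A0 \<noteq> 0 \<and>
    (\<forall>A. invertible A \<and> eval_entries p A \<noteq> 0 \<longrightarrow> lead_count I T Q A0 \<le> lead_count I T Q A)"
proof -
  let ?V = "part (act A0 ` I) T"
  define L where "L = leads ?V \<inter> Q"
  have fin: "finite L"
    using upper_set_finite[OF Q] by (simp add: L_def)
  have "\<forall>u\<in>L. \<exists>h\<in>part I T. lead_poly ?V u = act A0 h"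
    using lead_poly(1)[of _ ?V] part_act[OF A0] by (force simp: L_def)
  then obtain h where h: "\<And>u. u \<in> L \<Longrightarrow> h u \<in> part I T" "\<And>u. u \<in> L \<Longrightarrow> lead_poly ?V u = act A0 (h u)"
    by metis
  have "indep_family Q L (\<lambda>u. coef (lead_poly ?V u))"
    by (rule lead_poly_indep[OF fin]) (auto simp: L_def)
  then have "indep_family Q L (\<lambda>u n. coef (act A0 (h u)) n)"
    using h(2) by (auto simp: indep_family_def cong: sum.cong)
  from entries.indep_family_open[where a = "\<lambda>u n A. coef (act A (h u)) n", OF fin act_family_mem this]
  obtain p where p: "eval_entries p A0 \<noteq> 0"
    "\<And>A. eval_entries p A \<noteq> 0 \<Longrightarrow> indep_family Q L (\<lambda>u n. coef (act A (h u)) n)"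
    by auto
  have "card L \<le> lead_count I T Q A" if A: "invertible A" "eval_entries p A \<noteq> 0" for A
    unfolding lead_count_def
  proof (rule indep_card_le_leads[OF _ part_homog Q fin])
    show "kvec.subspace (part (act A ` I) T)"
      using graded_ideal_act[OF A(1) I] by (simp add: graded_ideal_def kvec_subspace_part)
    show "act A (h u) \<in> part (act A ` I) T" if "u \<in> L" for u
      using h(1)[OF that] by (simp add: part_act[OF A(1)])
  qed (use p(2)[OF A(2)] in simp)
  then show ?thesis
    using p(1) by (auto simp: L_def lead_count_def)
qed

text \<open>Finitely many of the numbers \<open>lead_count\<close> are maximal simultaneously on a nonempty open set.\<close>

lemma generic_lead_counts:
  fixes I :: "'k::field_char_0 poly3 set"
  assumes I: "graded_ideal I" and "finite F" "\<And>T Q. (T, Q) \<in> F \<Longrightarrow> upper_set T Q"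
  shows "\<exists>U. zariski_open_GL3 U \<and> U \<noteq> {} \<and> (\<forall>A\<in>U. invertible A \<and>
    (\<forall>(T, Q)\<in>F. \<forall>B. invertible B \<longrightarrow> lead_count I T Q B \<le> lead_count I T Q A))"
  using assms(2,3)
proof (induction F rule: finite_induct)
  case empty
  have one: "eval_entries 1 A = 1" for A :: "'k^3^3"
    by (simp add: eval_entries_eq eval.lin_ext_one)
  have "invertible (mat 1 :: 'k^3^3)"
    by (simp add: invertible_det_nz)
  then have "{A :: 'k^3^3. invertible A \<and> eval_entries 1 A \<noteq> 0} \<noteq> {}"
    by (auto simp: one)
  then show ?case
    using zariski_open_GL3_basic[of 1] by (intro exI[of _ "{A :: 'k^3^3. invertible A \<and> eval_entries 1 A \<noteq> 0}"]) auto
next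
  case (insert TQ F)
  obtain T Q where TQ: "TQ = (T, Q)"
    by (cases TQ)
  have Q: "upper_set T Q"
    using insert.prems TQ by blast
  have "\<exists>U. zariski_open_GL3 U \<and> U \<noteq> {} \<and> (\<forall>A\<in>U. invertible A \<and>
    (\<forall>(T, Q)\<in>F. \<forall>B. invertible B \<longrightarrow> lead_count I T Q B \<le> lead_count I T Q A))"
    by (rule insert.IH) (use insert.prems in blast)
  then obtain U where U: "zariski_open_GL3 U" "U \<noteq> {}" "\<And>A. A \<in> U \<Longrightarrow> invertible A"
    "\<And>A. A \<in> U \<Longrightarrow> \<forall>(T, Q)\<in>F. \<forall>B. invertible B \<longrightarrow> lead_count I T Q B \<le> lead_count I T Q A"
    by blast
  have "\<forall>B. invertible B \<longrightarrow> lead_count I T Q B \<le> card Q"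
    unfolding lead_count_def by (intro allI impI card_mono upper_set_finite[OF Q]) auto
  moreover have "invertible (mat 1 :: 'k^3^3)"
    by (simp add: invertible_det_nz)
  ultimately obtain A0 where A0: "invertible A0"
      "\<And>B. invertible B \<Longrightarrow> lead_count I T Q B \<le> lead_count I T Q A0"
    using ex_has_greatest_nat[of invertible "mat 1" "lead_count I T Q" "card Q + 1"] by (metis less_Suc_eq_le Suc_eq_plus1)
  obtain p where p: "eval_entries p A0 \<noteq> 0"
    "\<And>A. invertible A \<Longrightarrow> eval_entries p A \<noteq> 0 \<Longrightarrow> lead_count I T Q A0 \<le> lead_count I T Q A"
    using lead_count_open[OF I Q A0(1)] by blast
  define V where "V = {A. invertible A \<and> eval_entries p A \<noteq> 0}"
  have V: "zariski_open_GL3 V" "V \<noteq> {}"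
    using zariski_open_GL3_basic[of p] p(1) A0(1) by (auto simp: V_def)
  show ?case
  proof (intro exI[of _ "U \<inter> V"] conjI ballI)
    show "zariski_open_GL3 (U \<inter> V)"
      by (rule zariski_open_GL3_Int[OF U(1) V(1)])
    show "U \<inter> V \<noteq> {}"
      by (rule zariski_open_GL3_meet[OF U(1,2) V])
    fix A assume A: "A \<in> U \<inter> V"
    show "invertible A"
      using A U(3) by blast
    fix SR assume "SR \<in> insert TQ F"
    moreover have "lead_count I T Q B \<le> lead_count I T Q A" if "invertible B" for B
      using A0(2)[OF that] p(2)[of A] A by (auto simp: V_def)
    ultimately show "case SR of (T, Q) \<Rightarrow> \<forall>B. invertible B \<longrightarrow> lead_count I T Q B \<le> lead_count I T Q A"
      using U(4)[of A] A TQ by auto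
  qed
qed

section \<open>Exchanging the second variable for the first\<close>

text \<open>The substitution \<open>x\<^sub>2 \<mapsto> x\<^sub>2 + s x\<^sub>1\<close>.\<close>

definition shear :: "'k::comm_ring_1 \<Rightarrow> 'k^3^3"
  where "shear s = (\<chi> i j. if i = j then 1 else if i = 1 \<and> j = 2 then s else 0)"

lemma invertible_shear: "invertible (shear s :: 'k::field^3^3)"
  by (simp add: invertible_det_nz det_3 shear_def)

lemma shear_0: "shear 0 = mat 1"
  by (simp add: shear_def mat_def vec_eq_iff)

text \<open>The monomial \<open>x\<^sup>k\<close> with \<open>p\<close> factors \<open>x\<^sub>2\<close> replaced by \<open>x\<^sub>1\<close>; it has the degree of \<open>x\<^sup>k\<close> only for
  \<open>p \<le> k $ 2\<close>.\<close>

definition exchange :: "expo \<Rightarrow> nat \<Rightarrow> expo"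
  where "exchange k p = k + axis 1 p - axis 2 p"

lemma exchange_components [simp]:
  "exchange k p $ 1 = k $ 1 + p" "exchange k p $ 2 = k $ 2 - p" "exchange k p $ 3 = k $ 3"
  by (simp_all add: exchange_def)

lemma var_power: "var j ^ n = monom (axis j n)"
  using monom_axis_power[of j 1 n] by (simp add: var_def)

lemma act_shear_monom:
  "act_monom (shear s) k = (\<Sum>p\<le>k $ 2. const (of_nat (k $ 2 choose p) * s ^ p) * monom (exchange k p))"
proof -
  have lf: "lin_form (shear s) 1 = var 1" "lin_form (shear s) 2 = const s * var 1 + var 2"
    "lin_form (shear s) 3 = var 3"
    by (simp_all add: lin_form_def shear_def sum_3 const_simps)
  have "act_monom (shear s) k
      = var 1 ^ (k $ 1) * (\<Sum>p\<le>k $ 2. of_nat (k $ 2 choose p) * (const s * var 1) ^ p * var 2 ^ (k $ 2 - p))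
        * var 3 ^ (k $ 3)"
    by (simp add: act_monom_def prod_UNIV_3 lf binomial_ring)
  also have "\<dots> = (\<Sum>p\<le>k $ 2. const (of_nat (k $ 2 choose p) * s ^ p) * monom (exchange k p))"
    unfolding sum_distrib_left sum_distrib_right
  proof (rule sum.cong[OF refl])
    fix p assume "p \<in> {..k $ 2}"
    then have "exchange k p = axis 1 (k $ 1) + axis 1 p + axis 2 (k $ 2 - p) + axis 3 (k $ 3)"
      by (simp add: expo_eq_iff)
    then have "monom (exchange k p) = var 1 ^ (k $ 1) * var 1 ^ p * var 2 ^ (k $ 2 - p) * (var 3 ^ (k $ 3) :: 'a poly3)"
      by (simp only: monom_add var_power)
    moreover have "const (of_nat (k $ 2 choose p) * s ^ p) = of_nat (k $ 2 choose p) * const s ^ p"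
      by (simp add: const_simps const_power) (simp add: const_def)
    ultimately show "var 1 ^ k $ 1 * (of_nat (k $ 2 choose p) * (const s * var 1) ^ p * var 2 ^ (k $ 2 - p)) * var 3 ^ k $ 3
        = const (of_nat (k $ 2 choose p) * s ^ p) * monom (exchange k p)"
      by (simp add: power_mult_distrib mult_ac)
  qed
  finally show ?thesis .
qed

text \<open>The coefficient of \<open>x\<^sup>n\<close> in the sheared polynomial, as a polynomial in \<open>s\<close>.\<close>

definition shear_coef :: "'k::comm_ring_1 poly3 \<Rightarrow> expo \<Rightarrow> 'k poly"
  where "shear_coef f n = (\<Sum>k\<in>Poly_Mapping.keys f. \<Sum>p\<le>k $ 2.
    Polynomial.monom (if exchange k p = n then coef f k * of_nat (k $ 2 choose p) else 0) p)"

lemma poly_shear_coef: "poly (shear_coef f n) s = coef (act (shear s) f) n"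
  unfolding act_eq lin_ext_def act_shear_monom shear_coef_def poly_sum poly_monom lookup_sum
    lookup_const_times lookup_monom sum_distrib_left
  by (intro sum.cong refl) simp

lemma coeff_shear_coef_0: "coeff (shear_coef f n) 0 = coef f n"
  unfolding poly_0_coeff_0[symmetric] poly_shear_coef shear_0 act_mat_1 ..

lemma coeff_shear_coef_1:
  "coeff (shear_coef f n) 1
    = (\<Sum>k\<in>Poly_Mapping.keys f. if 1 \<le> k $ 2 \<and> exchange k 1 = n then coef f k * of_nat (k $ 2) else 0)"
  unfolding shear_coef_def coeff_sum coeff_monom
proof (rule sum.cong[OF refl])
  fix k
  have "(\<Sum>p\<le>k $ 2. if p = 1 then if exchange k p = n then coef f k * of_nat (k $ 2 choose p) else 0 else 0)
      = (if 1 \<le> k $ 2 \<and> exchange k 1 = n then coef f k * of_nat (k $ 2) else 0)"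
    by (simp add: sum.delta)
  then show "(\<Sum>p\<le>k $ 2. if p = 1 then if exchange k p = n then coef f k * of_nat (k $ 2 choose p) else 0 else 0)
      = (if 1 \<le> k $ 2 \<and> exchange k 1 = n then coef f k * of_nat (k $ 2) else 0)" .
qed

lemma exchange_1_less:
  assumes "revlex_less k u" "deg k = deg u" "1 \<le> k $ 2" "1 \<le> u $ 2"
  shows "revlex_less (exchange k 1) (exchange u 1)"
  using assms by (auto simp: revlex_less_def deg_eq)

lemma coeff_shear_coef_lead:
  assumes f: "f \<in> homog t" "is_lead f u" and u: "1 \<le> u $ 2"
  shows "coeff (shear_coef f (exchange u 1)) 1 = coef f u * of_nat (u $ 2)"
    and "revlex_less (exchange u 1) n \<Longrightarrow> coeff (shear_coef f n) 1 = 0"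
proof -
  have key: "k = u \<or> revlex_less k u" "deg k = deg u" if "k \<in> Poly_Mapping.keys f" for k
    using that f by (auto simp: is_lead_def homog_def)
  have uk: "u \<in> Poly_Mapping.keys f"
    using f(2) by (simp add: is_lead_def)
  have "1 \<le> k $ 2 \<and> exchange k 1 = exchange u 1 \<longleftrightarrow> k = u" if "k \<in> Poly_Mapping.keys f" for k
    using key[OF that] u exchange_1_less[of k u] by (metis revlex_less_irrefl)
  then have "coeff (shear_coef f (exchange u 1)) 1
      = (\<Sum>k\<in>Poly_Mapping.keys f. if k = u then coef f k * of_nat (k $ 2) else 0)"
    unfolding coeff_shear_coef_1 by (intro sum.cong refl) simp
  then show "coeff (shear_coef f (exchange u 1)) 1 = coef f u * of_nat (u $ 2)"
    using uk by (simp add: sum.delta)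
  assume n: "revlex_less (exchange u 1) n"
  show "coeff (shear_coef f n) 1 = 0"
    unfolding coeff_shear_coef_1
  proof (rule sum.neutral, rule ballI)
    fix k assume "k \<in> Poly_Mapping.keys f"
    then have "\<not> (1 \<le> k $ 2 \<and> exchange k 1 = n)"
      using key[of k] u n exchange_1_less[of k u] by (metis revlex_less_asym revlex_less_irrefl)
    then show "(if 1 \<le> k $ 2 \<and> exchange k 1 = n then coef f k * of_nat (k $ 2) else 0) = 0"
      by (rule if_not_P)
  qed
qed

interpretation polys: function_algebra "range poly :: ('k::field \<Rightarrow> 'k) set"
proof
  fix c :: 'k
  have "(\<lambda>x. c) = poly [:c:]"
    by (simp add: fun_eq_iff)
  then show "(\<lambda>x. c) \<in> range poly"
    by blast
next
  fix f g :: "'k \<Rightarrow> 'k"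
  assume "f \<in> range poly" "g \<in> range poly"
  then obtain p q where pq: "f = poly p" "g = poly q"
    by blast
  have "(\<lambda>x. f x + g x) = poly (p + q)" "(\<lambda>x. f x * g x) = poly (p * q)"
    by (simp_all add: fun_eq_iff pq)
  then show "(\<lambda>x. f x + g x) \<in> range poly" "(\<lambda>x. f x * g x) \<in> range poly"
    by blast+
qed

lemma indep_family_cong:
  "(\<And>i u. i \<in> I \<Longrightarrow> u \<in> Q \<Longrightarrow> v i u = w i u) \<Longrightarrow> indep_family Q I v \<longleftrightarrow> indep_family Q I w"
  unfolding indep_family_def by (simp cong: sum.cong)

text \<open>If the exchange of \<open>x\<^sub>2\<close> for \<open>x\<^sub>1\<close> led out of the leading monomials, then a suitable shear
  would increase the number of leading monomials that are at least the exchanged monomial: the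
  polynomial with leading monomial \<open>u\<close> acquires, to first order in \<open>s\<close>, the new leading monomial
  \<open>exchange u 1\<close>.\<close>

lemma exchange_in_leads:
  fixes K :: "'k::field_char_0 poly3 set"
  assumes K: "graded_ideal K"
    and max: "\<And>E Q. invertible E \<Longrightarrow> upper_set t Q \<Longrightarrow>
      card (leads (part (act E ` K) t) \<inter> Q) \<le> card (leads (part K t) \<inter> Q)"
    and u: "u \<in> leads (part K t)" "1 \<le> u $ 2"
  shows "exchange u 1 \<in> leads (part K t)"
proof (rule ccontr)
  let ?V = "part K t" and ?m = "exchange u 1"
  assume not: "?m \<notin> leads ?V"
  have degu: "deg u = t"
    using u(1) leads_deg[OF part_homog] by blast
  have degm: "deg ?m = t"
    using degu u(2) by (simp add: deg_eq)
  have um: "revlex_less u ?m"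
    using u(2) degu degm by (simp add: revlex_less_def)
  define Q where "Q = {n. deg n = t \<and> (n = ?m \<or> revlex_less ?m n)}"
  have Q: "upper_set t Q"
    unfolding upper_set_def Q_def using revlex_less_trans by blast
  define L where "L = leads ?V \<inter> Q"
  have L: "finite L" "?m \<notin> L"
    using not upper_set_finite[OF Q] by (auto simp: L_def)
  define f where "f = lead_poly ?V u"
  have f: "f \<in> ?V" "f \<in> homog t" "is_lead f u"
    using lead_poly[OF u(1)] by (auto simp: f_def part_def)
  have less: "revlex_less u n" if "n \<in> Q" for n
    using that um revlex_less_trans by (auto simp: Q_def)
  \<comment> \<open>On \<open>Q\<close> the coefficients of the sheared \<open>f\<close> vanish at \<open>s = 0\<close>.  Divided by \<open>s\<close>, they become
    at \<open>s = 0\<close> the coefficients of a nonzero multiple of the exchanged monomial.\<close>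
  have "\<forall>n\<in>Q. \<exists>q. shear_coef f n = pCons 0 q"
  proof
    fix n assume "n \<in> Q"
    then have "coeff (shear_coef f n) 0 = 0"
      using less is_lead_greater[OF f(3)] by (simp add: coeff_shear_coef_0)
    then show "\<exists>q. shear_coef f n = pCons 0 q"
      by (cases "shear_coef f n") auto
  qed
  then obtain q where q: "\<And>n. n \<in> Q \<Longrightarrow> shear_coef f n = pCons 0 (q n)"
    by metis
  have q0: "poly (q n) 0 = (if n = ?m then coef f u * of_nat (u $ 2) else 0)" if "n \<in> Q" for n
  proof -
    have "poly (q n) 0 = coeff (shear_coef f n) 1"
      using q[OF that] by (simp add: poly_0_coeff_0)
    then show ?thesis
      using coeff_shear_coef_lead[OF f(2,3) u(2)] that by (auto simp: Q_def)
  qed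
  define a where "a i n = (if i = ?m then poly (q n) else poly (shear_coef (lead_poly ?V i) n))" for i n
  define g where "g i = (if i = ?m then const (coef f u * of_nat (u $ 2)) * monom ?m else lead_poly ?V i)" for i
  have "coef f u * of_nat (u $ 2) \<noteq> 0"
    using is_lead_coef[OF f(3)] u(2) by simp
  then have "is_lead (g i) i" if "i \<in> insert ?m L" for i
    using that lead_poly(2)[of i ?V] by (auto simp: g_def is_lead_def const_times_monom L_def split: if_splits)
  then have "indep_family Q (insert ?m L) (\<lambda>i. coef (g i))"
    using L degm by (intro lead_family_indep[where m = id]) (auto simp: L_def Q_def)
  moreover have a0: "a i n 0 = coef (g i) n" if "i \<in> insert ?m L" "n \<in> Q" for i n
    using that q0[of n] by (auto simp: a_def g_def poly_0_coeff_0 coeff_shear_coef_0 lookup_monom)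
  ultimately have indep0: "indep_family Q (insert ?m L) (\<lambda>i n. a i n 0)"
    by (subst indep_family_cong[where w = "\<lambda>i. coef (g i)", OF a0])
  have fin: "finite (insert ?m L)"
    using L by simp
  have "a i n \<in> range poly" for i n
    by (simp add: a_def)
  from polys.indep_family_open[where a = a, OF fin this indep0]
  obtain p where p: "poly p 0 \<noteq> 0" "\<And>s. poly p s \<noteq> 0 \<Longrightarrow> indep_family Q (insert ?m L) (\<lambda>i n. a i n s)"
    by auto
  have "p * [:0, 1:] \<noteq> 0"
    using p(1) by auto
  then have "finite {s. poly (p * [:0, 1:]) s = 0}"
    by (rule poly_roots_finite)
  then obtain s where "poly (p * [:0, 1:]) s \<noteq> 0"
    using infinite_UNIV_char_0[where 'a = 'k] by (metis (mono_tags) ex_new_if_finite mem_Collect_eq)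
  then have s: "poly p s \<noteq> 0" "s \<noteq> 0"
    by auto
  define h where "h i = (if i = ?m then const (1 / s) * act (shear s) f else act (shear s) (lead_poly ?V i))" for i
  have sub: "kvec.subspace (part (act (shear s) ` K) t)"
    using graded_ideal_act[OF invertible_shear K] by (simp add: graded_ideal_def kvec_subspace_part)
  have "card (insert ?m L) \<le> card (leads (part (act (shear s) ` K) t) \<inter> Q)"
  proof (rule indep_card_le_leads[OF sub part_homog Q fin])
    fix i assume "i \<in> insert ?m L"
    then show "h i \<in> part (act (shear s) ` K) t"
      using f(1) lead_poly(1)[of i ?V] kvec.subspace_scale[OF sub]
      by (auto simp: h_def part_act[OF invertible_shear] L_def)
  next
    have as: "a i n s = coef (h i) n" if "i \<in> insert ?m L" "n \<in> Q" for i n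
    proof (cases "i = ?m")
      case True
      have "s * poly (q n) s = coef (act (shear s) f) n"
        using q[OF that(2)] by (simp add: poly_shear_coef[symmetric])
      then have "poly (q n) s = 1 / s * coef (act (shear s) f) n"
        using s(2) by (simp add: field_simps)
      then show ?thesis
        using True by (simp add: a_def h_def)
    qed (simp add: a_def h_def poly_shear_coef)
    then show "indep_family Q (insert ?m L) (\<lambda>i. coef (h i))"
      using p(2)[OF s(1)] by (subst (asm) indep_family_cong[where w = "\<lambda>i. coef (h i)", OF as])
  qed
  also have "\<dots> \<le> card L"
    unfolding L_def by (rule max[OF invertible_shear Q])
  finally show False
    using L by simp
qed

section \<open>The strong Lefschetz property\<close>

text \<open>Multiplication by \<open>l ^ b\<close> is injective or surjective from degree \<open>t\<close> to degree \<open>t + b\<close>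
  of \<open>S/I\<close>.\<close>

definition max_rank :: "'k::comm_ring_1 poly3 set \<Rightarrow> 'k poly3 \<Rightarrow> nat \<Rightarrow> nat \<Rightarrow> bool"
  where "max_rank I l b t \<longleftrightarrow> (\<forall>g\<in>homog t. l ^ b * g \<in> I \<longrightarrow> g \<in> I) \<or>
    (\<forall>w\<in>homog (t + b). \<exists>g\<in>homog t. w - l ^ b * g \<in> I)"

lemma cong_rel_class_eq_iff:
  "ideal.subspace I \<Longrightarrow> cong_rel I `` {f} = cong_rel I `` {g} \<longleftrightarrow> f - g \<in> I"
  using eq_equiv_class_iff[OF equiv_cong_rel, of I f g] by (simp add: cong_rel_def)

lemma SLP_max_rank:
  fixes I :: "'k::comm_ring_1 poly3 set"
  assumes I: "ideal.subspace I" and "SLP I"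
  shows "\<exists>l\<in>homog 1. \<forall>b\<ge>1. \<forall>t. max_rank I l b t"
proof -
  obtain l where l: "l \<in> homog 1" and slp: "\<forall>b\<ge>1. \<forall>t.
      inj_on (quot_mult I (l ^ b)) (quot_comp I t) \<or>
      quot_mult I (l ^ b) ` quot_comp I t = quot_comp I (t + b)"
    using assms(2) unfolding SLP_def by (rule bexE)
  have "max_rank I l b t" if "b \<ge> 1" for b t
  proof (cases "inj_on (quot_mult I (l ^ b)) (quot_comp I t)")
    case True
    have "g \<in> I" if g: "g \<in> homog t" "l ^ b * g \<in> I" for g
    proof -
      have "quot_mult I (l ^ b) (cong_rel I `` {g}) = quot_mult I (l ^ b) (cong_rel I `` {0})"
        using g(2) by (simp add: quot_mult_coset[OF I] cong_rel_class_eq_iff[OF I])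
      moreover have "cong_rel I `` {g} \<in> quot_comp I t" "cong_rel I `` {0} \<in> quot_comp I t"
        unfolding quot_comp_def
        using g(1) kvec.subspace_0[OF kvec_subspace_homog] by (auto intro!: quotientI)
      ultimately have "cong_rel I `` {g} = cong_rel I `` {0}"
        using True by (auto dest: inj_onD)
      then show "g \<in> I"
        by (simp add: cong_rel_class_eq_iff[OF I])
    qed
    then show ?thesis
      by (auto simp: max_rank_def)
  next
    case False
    then have surj: "quot_mult I (l ^ b) ` quot_comp I t = quot_comp I (t + b)"
      using slp[rule_format, OF that, of t] by (simp only: simp_thms)
    have "\<exists>g\<in>homog t. w - l ^ b * g \<in> I" if "w \<in> homog (t + b)" for w
    proof -
      have "cong_rel I `` {w} \<in> quot_mult I (l ^ b) ` quot_comp I t"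
        unfolding surj unfolding quot_comp_def using that by (rule quotientI)
      then obtain g where "g \<in> homog t" "cong_rel I `` {w} = quot_mult I (l ^ b) (cong_rel I `` {g})"
        unfolding quot_comp_def by (auto elim!: quotientE)
      then show ?thesis
        by (auto simp: quot_mult_coset[OF I] cong_rel_class_eq_iff[OF I])
    qed
    then show ?thesis
      by (auto simp: max_rank_def)
  qed
  then show ?thesis
    using l by blast
qed

lemma linear_form_eq_sum:
  fixes l :: "'k::comm_ring_1 poly3"
  assumes "l \<in> homog 1"
  shows "l = (\<Sum>i\<in>UNIV. const (coef l (axis i 1)) * var i)"
proof (rule poly_mapping_eqI)
  fix n :: expo
  have "n = axis 1 1 \<or> n = axis 2 1 \<or> n = axis 3 1 \<or> deg n \<noteq> 1"
    unfolding expo_eq_iff deg_eq axis_components by arith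
  then consider "n = axis 1 1" | "n = axis 2 1" | "n = axis 3 1" | "deg n \<noteq> 1"
    by blast
  then show "coef l n = coef (\<Sum>i\<in>UNIV. const (coef l (axis i 1)) * var i) n"
  proof cases
    case 4
    then have "axis i 1 \<noteq> n" for i
      by auto
    moreover have "coef l n = 0"
      using 4 assms coef_homog by blast
    ultimately show ?thesis
      by (simp add: lookup_sum var_def lookup_monom)
  qed (simp_all add: sum_3 lookup_add var_def lookup_monom axis_eq_axis)
qed

text \<open>A coordinate change that moves a given nonzero linear form to \<open>x\<^sub>3\<close>.\<close>

lemma exists_act_eq_var3:
  fixes l :: "'k::field poly3"
  assumes l: "l \<in> homog 1" "l \<noteq> 0"
  shows "\<exists>A. invertible A \<and> act A l = var 3"
proof -
  define c where "c i = coef l (axis i 1)" for i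
  have l_eq: "l = (\<Sum>i\<in>UNIV. const (c i) * var i)"
    using linear_form_eq_sum[OF l(1)] by (simp add: c_def)
  have "\<exists>M :: 'k^3^3. invertible M \<and> (\<forall>i. M $ i $ 3 = c i)"
  proof -
    let ?M1 = "vector [vector [0, 0, c 1], vector [1, 0, c 2], vector [0, 1, c 3]] :: 'k^3^3"
    let ?M2 = "vector [vector [1, 0, c 1], vector [0, 0, c 2], vector [0, 1, c 3]] :: 'k^3^3"
    let ?M3 = "vector [vector [1, 0, c 1], vector [0, 1, c 2], vector [0, 0, c 3]] :: 'k^3^3"
    have det: "det ?M1 = c 1" "det ?M2 = - c 2" "det ?M3 = c 3"
      by (simp_all add: det_3)
    have col: "?M1 $ i $ 3 = c i" "?M2 $ i $ 3 = c i" "?M3 $ i $ 3 = c i" for i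
      using exhaust_3[of i] by auto
    have "c 1 \<noteq> 0 \<or> c 2 \<noteq> 0 \<or> c 3 \<noteq> 0"
      using l(2) l_eq by (auto simp: sum_3 const_simps)
    then have "invertible ?M1 \<or> invertible ?M2 \<or> invertible ?M3"
      unfolding invertible_det_nz det by simp
    then show ?thesis
      using col by blast
  qed
  then obtain M :: "'k^3^3" where M: "invertible M" "\<And>i. M $ i $ 3 = c i"
    by blast
  have "act M (var 3) = l"
    by (simp add: act_var lin_form_def M(2) l_eq)
  moreover obtain B where "invertible B" "\<And>f. act B (act M f) = f"
    using act_inverse[OF M(1)] by metis
  ultimately show ?thesis
    by metis
qed

lemma lefschetz_x3_of_max_rank:
  fixes K :: "'k::field poly3 set"
  assumes K: "graded_ideal K" and rank: "\<And>b t. b \<ge> 1 \<Longrightarrow> max_rank K (var 3) b t"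
  shows "lefschetz_x3 (leads K)"
  unfolding lefschetz_x3_def
proof (intro allI impI)
  fix b t :: nat assume "1 \<le> b"
  let ?x = "monom (axis 3 b) :: 'k poly3"
  consider (inj) "\<And>g. g \<in> homog t \<Longrightarrow> ?x * g \<in> K \<Longrightarrow> g \<in> K"
    | (surj) "\<And>w. w \<in> homog (t + b) \<Longrightarrow> \<exists>g\<in>homog t. w - ?x * g \<in> K"
    using rank[OF \<open>1 \<le> b\<close>, of t] unfolding max_rank_def var_power by blast
  then show "(\<forall>n. deg n = t + b \<and> n $ 3 < b \<longrightarrow> n \<in> leads K) \<or>
    (\<forall>n\<in>leads K. deg n = t + b \<and> b \<le> n $ 3 \<longrightarrow> n - axis 3 b \<in> leads K)"
  proof cases
    case inj
    have "n - axis 3 b \<in> leads K" if n: "n \<in> leads K" "deg n = t + b" "b \<le> n $ 3" for n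
    proof -
      obtain f where f: "f \<in> K" "f \<in> homog (t + b)" "is_lead f n"
        using n leads_part[OF K, of "t + b"] by (auto simp: leads_def part_def)
      \<comment> \<open>In the reverse lexicographic order every monomial of \<open>f\<close> is divisible by the power of
        \<open>x\<^sub>3\<close> that divides the leading one.\<close>
      have key: "b \<le> k $ 3 \<and> deg k = t + b" if "k \<in> Poly_Mapping.keys f" for k
        using that f(2,3) n(2,3) by (fastforce simp: is_lead_def homog_def revlex_less_def)
      define g where "g = (\<Sum>k\<in>Poly_Mapping.keys f. const (coef f k) * monom (k - axis 3 b))"
      have "?x * g = (\<Sum>k\<in>Poly_Mapping.keys f. const (coef f k) * monom k)"
        unfolding g_def sum_distrib_left
      proof (rule sum.cong[OF refl])
        fix k assume "k \<in> Poly_Mapping.keys f"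
        then have "axis 3 b + (k - axis 3 b) = k"
          using key by (simp add: expo_eq_iff)
        then have "?x * monom (k - axis 3 b) = monom k"
          by (metis monom_add)
        then show "?x * (const (coef f k) * monom (k - axis 3 b)) = const (coef f k) * monom k"
          by (simp add: mult.left_commute)
      qed
      then have xg: "?x * g = f"
        by (simp add: poly3_sum_monom[symmetric])
      have "g \<in> homog t"
        unfolding g_def
      proof (intro kvec.subspace_sum[OF kvec_subspace_homog] homog_const_times)
        fix k assume "k \<in> Poly_Mapping.keys f"
        then show "monom (k - axis 3 b) \<in> homog t"
          using key[of k] by (simp add: homog_monom deg_eq)
      qed
      then have "g \<in> K"
        using inj xg f(1) by simp
      have "g \<noteq> 0"
        using xg f(3) by (auto simp: is_lead_def)
      then obtain m where m: "is_lead g m"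
        using is_lead_exists by blast
      then have "is_lead f (m + axis 3 b)"
        using is_lead_monom_times[OF m, of "axis 3 b"] xg by simp
      then have "n = m + axis 3 b"
        using f(3) by (metis is_lead_def revlex_less_asym)
      then have "n - axis 3 b = m"
        by (simp add: expo_eq_iff)
      then show ?thesis
        using m \<open>g \<in> K\<close> by (auto simp: leads_def)
    qed
    then show ?thesis
      by blast
  next
    case surj
    have "n \<in> leads K" if n: "deg n = t + b" "n $ 3 < b" for n
    proof -
      obtain g where g: "g \<in> homog t" "monom n - ?x * g \<in> K"
        using surj n(1) by (metis homog_monom)
      have key: "b \<le> k $ 3 \<and> deg k = t + b" if "coef (?x * g) k \<noteq> 0" for k
      proof -
        have "k \<in> (+) (axis 3 b) ` Poly_Mapping.keys g"
          using that unfolding keys_monom_times[symmetric] by (simp add: in_keys_iff)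
        then show ?thesis
          using g(1) by (auto simp: homog_def)
      qed
      have 0: "coef (?x * g) n = 0"
        using key[of n] n(2) by linarith
      have "is_lead (monom n - ?x * g) n"
        unfolding is_lead_def in_keys_iff lookup_minus lookup_monom
      proof (intro conjI ballI impI)
        show "(if n = n then 1 else 0) - coef (?x * g) n \<noteq> 0"
          by (simp add: 0)
        fix k assume "k \<in> Poly_Mapping.keys (monom n - ?x * g)" "k \<noteq> n"
        then have "coef (?x * g) k \<noteq> 0"
          by (simp add: in_keys_iff lookup_minus lookup_monom)
        then show "revlex_less k n"
          using key[of k] n by (simp add: revlex_less_def)
      qed
      then show ?thesis
        using g(2) by (auto simp: leads_def)
    qed
    then show ?thesis
      by blast
  qed
qed

lemma SLP_lefschetz_x3:
  fixes I :: "'k::field poly3 set"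
  assumes I: "graded_ideal I" and "SLP I"
  shows "\<exists>A. invertible A \<and> lefschetz_x3 (leads (act A ` I))"
proof -
  have subI: "ideal.subspace I"
    using I by (simp add: graded_ideal_def)
  obtain l0 where l0: "l0 \<in> homog 1" "\<And>b t. b \<ge> 1 \<Longrightarrow> max_rank I l0 b t"
    using SLP_max_rank[OF subI assms(2)] by blast
  obtain l where l: "l \<in> homog 1" "l \<noteq> 0" "\<And>b t. b \<ge> 1 \<Longrightarrow> max_rank I l b t"
  proof (cases "l0 = 0")
    case False
    then show ?thesis
      using that l0 by blast
  next
    case True
    \<comment> \<open>If the zero form has maximal rank, then the source or the target vanishes, and every
      linear form has maximal rank.\<close>
    have "max_rank I (var 3) b t" if "b \<ge> 1" for b t
      using l0(2)[OF that, of t] that ideal.subspace_0[OF subI] kvec.subspace_0[OF kvec_subspace_homog]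
      unfolding max_rank_def True by (auto simp: power_0_left intro!: bexI[of _ 0])
    moreover have "var 3 \<noteq> (0 :: 'k poly3)"
      by (metis keys_monom keys_zero insert_not_empty var_def)
    ultimately show ?thesis
      using that homog_var by blast
  qed
  obtain A where A: "invertible A" "act A l = var 3"
    using exists_act_eq_var3[OF l(1,2)] by blast
  obtain B where B: "\<And>f. act B (act A f) = f" "\<And>f. act A (act B f) = f"
    using act_inverse[OF A(1)] by metis
  have mem: "act A f \<in> act A ` I \<longleftrightarrow> f \<in> I" for f
    using B(1) by (metis (no_types, lifting) image_iff)
  have "max_rank (act A ` I) (var 3) b t" if b: "b \<ge> 1" for b t
  proof -
    consider (inj) "\<forall>g\<in>homog t. l ^ b * g \<in> I \<longrightarrow> g \<in> I"
      | (surj) "\<forall>w\<in>homog (t + b). \<exists>g\<in>homog t. w - l ^ b * g \<in> I"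
      using l(3)[OF b, of t] unfolding max_rank_def by blast
    then show ?thesis
    proof cases
      case *: inj
      have "g \<in> act A ` I" if "g \<in> homog t" "var 3 ^ b * g \<in> act A ` I" for g
      proof -
        have "var 3 ^ b * g = act A (l ^ b * act B g)"
          by (simp add: act_mult act_power A(2) B(2))
        then have "act B g \<in> I"
          using * that homog_act[OF that(1)] mem by metis
        then show ?thesis
          using mem[of "act B g"] B(2) by simp
      qed
      then show ?thesis
        by (auto simp: max_rank_def)
    next
      case *: surj
      have "\<exists>g\<in>homog t. w - var 3 ^ b * g \<in> act A ` I" if w: "w \<in> homog (t + b)" for w
      proof -
        obtain g where g: "g \<in> homog t" "act B w - l ^ b * g \<in> I"
          using * homog_act[OF w] by blast
        then have "act A (act B w - l ^ b * g) \<in> act A ` I"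
          by blast
        then have "w - var 3 ^ b * act A g \<in> act A ` I"
          by (simp add: act_minus act_mult act_power A(2) B(2))
        then show ?thesis
          using homog_act[OF g(1)] by blast
      qed
      then show ?thesis
        by (auto simp: max_rank_def)
    qed
  qed
  then show ?thesis
    using A(1) lefschetz_x3_of_max_rank[OF graded_ideal_act[OF A(1) I]] by blast
qed

text \<open>The combinatorial form of the strong Lefschetz property passes to any monomial ideal with
  the same Hilbert function that has in each degree, for every \<open>b\<close>, at least as many monomials
  not divisible by \<open>x\<^sub>3\<^sup>b\<close>.\<close>

lemma lefschetz_x3_transfer:
  assumes L0: "lefschetz_x3 L0" and L: "up_closed L"
    and card: "\<And>t. card {u\<in>L. deg u = t} = card {u\<in>L0. deg u = t}"
    and more: "\<And>b T. card {u\<in>L0. deg u = T \<and> u $ 3 < b} \<le> card {u\<in>L. deg u = T \<and> u $ 3 < b}"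
  shows "lefschetz_x3 L"
  unfolding lefschetz_x3_def
proof (intro allI impI)
  fix b t :: nat assume "1 \<le> b"
  have fin [simp]: "finite {u\<in>M. deg u = s \<and> P u}" "finite {u\<in>M. deg u = s}" "finite {u. deg u = s \<and> P u}" for M s P
    by (auto intro: finite_subset[OF _ finite_deg_eq[of s]])
  consider (surj) "\<forall>n. deg n = t + b \<and> n $ 3 < b \<longrightarrow> n \<in> L0"
    | (inj) "\<forall>n\<in>L0. deg n = t + b \<and> b \<le> n $ 3 \<longrightarrow> n - axis 3 b \<in> L0"
    using L0 \<open>1 \<le> b\<close> unfolding lefschetz_x3_def by blast
  then show "(\<forall>n. deg n = t + b \<and> n $ 3 < b \<longrightarrow> n \<in> L) \<or>
    (\<forall>n\<in>L. deg n = t + b \<and> b \<le> n $ 3 \<longrightarrow> n - axis 3 b \<in> L)"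
  proof cases
    case surj
    then have "{u\<in>L0. deg u = t + b \<and> u $ 3 < b} = {u. deg u = t + b \<and> u $ 3 < b}"
      by blast
    then have "card {u. deg u = t + b \<and> u $ 3 < b} \<le> card {u\<in>L. deg u = t + b \<and> u $ 3 < b}"
      using more[of "t + b" b] by simp
    then have "{u\<in>L. deg u = t + b \<and> u $ 3 < b} = {u. deg u = t + b \<and> u $ 3 < b}"
      by (intro card_seteq) auto
    then show ?thesis
      by blast
  next
    case inj
    have split: "card {u\<in>M. deg u = t + b}
        = card {u\<in>M. deg u = t + b \<and> u $ 3 < b} + card {u\<in>M. deg u = t + b \<and> b \<le> u $ 3}" for M
      by (subst card_Un_disjoint[symmetric]) (auto intro!: arg_cong[of _ _ card])
    have "card {u\<in>L0. deg u = t + b \<and> b \<le> u $ 3} \<le> card {u\<in>L0. deg u = t}"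
    proof (rule card_inj_on_le[where f = "\<lambda>n. n - axis 3 b"])
      show "inj_on (\<lambda>n. n - axis 3 b) {u\<in>L0. deg u = t + b \<and> b \<le> u $ 3}"
        by (auto simp: inj_on_def expo_eq_iff)
      show "(\<lambda>n. n - axis 3 b) ` {u\<in>L0. deg u = t + b \<and> b \<le> u $ 3} \<subseteq> {u\<in>L0. deg u = t}"
        using inj by (auto simp: deg_eq)
    qed simp
    then have "card {u\<in>L. deg u = t + b \<and> b \<le> u $ 3} \<le> card {u\<in>L. deg u = t}"
      using split[of L] split[of L0] card[of t] card[of "t + b"] more[of "t + b" b] by linarith
    also have "\<dots> = card ((\<lambda>u. u + axis 3 b) ` {u\<in>L. deg u = t})"
      by (rule card_image[symmetric]) (auto simp: inj_on_def)
    finally have "(\<lambda>u. u + axis 3 b) ` {u\<in>L. deg u = t} = {u\<in>L. deg u = t + b \<and> b \<le> u $ 3}"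
      using up_closedD[OF L] by (intro card_seteq) auto
    moreover have "(u + axis 3 b) - axis 3 b = u" for u :: expo
      by (simp add: expo_eq_iff)
    ultimately have "\<forall>n\<in>L. deg n = t + b \<and> b \<le> n $ 3 \<longrightarrow> n - axis 3 b \<in> L"
      by (metis (mono_tags, lifting) imageE mem_Collect_eq)
    then show ?thesis
      by blast
  qed
qed

section \<open>The generic initial ideal\<close>

lemma homog_subset_act:
  assumes "invertible A" "homog t \<subseteq> I"
  shows "{u. deg u = t} \<subseteq> leads (act A ` (I :: 'k::comm_ring_1 poly3 set))"
proof
  fix u assume u: "u \<in> {u. deg u = t}"
  obtain B where B: "\<And>f. act A (act B f) = f"
    using act_inverse[OF assms(1)] by metis
  have "act B (monom u) \<in> I"
    using assms(2) u by (auto intro!: homog_act simp: homog_monom)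
  then have "monom u \<in> act A ` I"
    using B by (metis imageI)
  moreover have "is_lead (monom u :: 'k poly3) u"
    by (simp add: is_lead_def)
  ultimately show "u \<in> leads (act A ` I)"
    by (auto simp: leads_def)
qed

lemma upper_set_x3: "upper_set t {u. deg u = t \<and> u $ 3 < b}"
proof -
  have "v $ 3 < b" if "deg u = deg v" "u $ 3 < b" "revlex_less u v" for u v
    using that unfolding revlex_less_def by linarith
  then show ?thesis
    unfolding upper_set_def by blast
qed

text \<open>For a homogeneous ideal of finite colength the strong Lefschetz property alone makes the
  generic initial ideal almost reverse lexicographic.\<close>

lemma Gin_almost_revlex:
  fixes I :: "'k::field_char_0 poly3 set"
  assumes I: "graded_ideal I" and slp: "SLP I" and fin: "\<And>t. D \<le> t \<Longrightarrow> homog t \<subseteq> I"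
  shows "\<exists>L. up_closed L \<and> almost_revlex (monomial_span L :: 'k poly3 set) \<and>
    is_Gin I (monomial_span L) \<and> (\<forall>t. card {u\<in>L. deg u = t} = card (leads (part I t)))"
proof -
  define F where "F = (SIGMA T:{..D}. {Q. upper_set T Q})"
  have "finite F"
    unfolding F_def
  proof (rule finite_SigmaI)
    fix T
    have "{Q. upper_set T Q} \<subseteq> Pow {u. deg u = T}"
      by (auto simp: upper_set_def)
    then show "finite {Q. upper_set T Q}"
      by (rule finite_subset) simp
  qed simp
  moreover have "upper_set T Q" if "(T, Q) \<in> F" for T Q
    using that by (simp add: F_def)
  ultimately have "\<exists>U. zariski_open_GL3 U \<and> U \<noteq> {} \<and> (\<forall>A\<in>U. invertible A \<and>
      (\<forall>(T, Q)\<in>F. \<forall>B. invertible B \<longrightarrow> lead_count I T Q B \<le> lead_count I T Q A))"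
    by (rule generic_lead_counts[OF I])
  then obtain U where U: "zariski_open_GL3 U" "U \<noteq> {}"
    and inv: "\<And>A. A \<in> U \<Longrightarrow> invertible A"
    and "\<And>A. A \<in> U \<Longrightarrow> \<forall>(T, Q)\<in>F. \<forall>B. invertible B \<longrightarrow> lead_count I T Q B \<le> lead_count I T Q A"
    by blast
  then have max: "lead_count I T Q B \<le> lead_count I T Q A"
    if "A \<in> U" "T \<le> D" "upper_set T Q" "invertible B" for A B T Q
    using that by (auto simp: F_def)
  obtain A0 where A0: "invertible A0" "lefschetz_x3 (leads (act A0 ` I))"
    using SLP_lefschetz_x3[OF I slp] by blast
  have gr: "graded_ideal (act A ` I)" "ideal.subspace (act A ` I)" if "invertible A" for A
    using graded_ideal_act[OF that I] by (simp_all add: graded_ideal_def)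
  have card: "card {u\<in>leads (act A ` I). deg u = t} = card (leads (part I t))" if "invertible A" for A t
    using card_leads_part_act[OF that I] leads_part[OF gr(1)[OF that]] by simp
  have up: "up_closed (leads (act A ` I))" if "invertible A" for A
    by (rule up_closed_leads[OF gr(2)[OF that]])
  have ar: "almost_revlex (monomial_span (leads (act A ` I)) :: 'k poly3 set)" if A: "A \<in> U" for A
  proof (rule almost_revlexI)
    let ?L = "leads (act A ` I)"
    show "up_closed ?L"
      by (rule up[OF inv[OF A]])
    show "exchange_closed ?L"
      unfolding exchange_closed_def
    proof (intro ballI impI)
      fix u assume u: "u \<in> ?L" "1 \<le> u $ 2"
      have "exchange u 1 \<in> ?L"
      proof (cases "deg u \<le> D")
        case True
        have "exchange u 1 \<in> leads (part (act A ` I) (deg u))"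
        proof (rule exchange_in_leads[OF gr(1)[OF inv[OF A]] _ _ u(2)])
          fix E :: "'k^3^3" and Q assume E: "invertible E" "upper_set (deg u) Q"
          have "act E ` act A ` I = act (E ** A) ` I"
            by (simp add: image_image act_act)
          moreover have "invertible (E ** A)"
            using E(1) inv[OF A] by (rule invertible_mult)
          ultimately show "card (leads (part (act E ` act A ` I) (deg u)) \<inter> Q)
              \<le> card (leads (part (act A ` I) (deg u)) \<inter> Q)"
            using max[OF A True E(2)] by (simp add: lead_count_def)
        next
          show "u \<in> leads (part (act A ` I) (deg u))"
            using u(1) by (simp add: leads_part[OF gr(1)[OF inv[OF A]]])
        qed
        then show ?thesis
          by (simp add: leads_part[OF gr(1)[OF inv[OF A]]])
      next
        case False
        moreover have "deg (exchange u 1) = deg u"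
          using u(2) by (simp add: deg_eq)
        ultimately show ?thesis
          using homog_subset_act[OF inv[OF A] fin[of "deg u"]] by auto
      qed
      then show "u + axis 1 1 - axis 2 1 \<in> ?L"
        by (simp add: exchange_def)
    qed
    show "lefschetz_x3 ?L"
    proof (rule lefschetz_x3_transfer[OF A0(2) up[OF inv[OF A]]])
      show "card {u\<in>?L. deg u = t} = card {u\<in>leads (act A0 ` I). deg u = t}" for t
        unfolding card[OF inv[OF A]] card[OF A0(1)] ..
      fix b T :: nat
      let ?Q = "{u. deg u = T \<and> u $ 3 < b}"
      have Q: "upper_set T ?Q"
        by (rule upper_set_x3)
      have count: "lead_count I T ?Q B = card {u\<in>leads (act B ` I). deg u = T \<and> u $ 3 < b}"
        if "invertible B" for B
      proof -
        have "{u\<in>leads (act B ` I). deg u = T} \<inter> ?Q = {u\<in>leads (act B ` I). deg u = T \<and> u $ 3 < b}"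
          by blast
        then show ?thesis
          unfolding lead_count_def leads_part[OF gr(1)[OF that]] by (rule arg_cong)
      qed
      show "card {u\<in>leads (act A0 ` I). deg u = T \<and> u $ 3 < b} \<le> card {u\<in>?L. deg u = T \<and> u $ 3 < b}"
      proof (cases "T \<le> D")
        case True
        show ?thesis
          using max[OF A True Q A0(1)] unfolding count[OF inv[OF A]] count[OF A0(1)] .
      next
        case False
        then have "{u. deg u = T} \<subseteq> ?L"
          by (intro homog_subset_act[OF inv[OF A]] fin) simp
        then show ?thesis
          by (intro card_mono finite_subset[OF _ finite_deg_eq[of T]]) auto
      qed
    qed
  qed
  obtain A1 where A1: "A1 \<in> U"
    using U(2) by blast
  have "leads (act A ` I) = leads (act A1 ` I)" if A: "A \<in> U" for A
    by (rule almost_revlex_unique[OF up[OF inv[OF A]] ar[OF A] up[OF inv[OF A1]] ar[OF A1]])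
      (simp only: card[OF inv[OF A]] card[OF inv[OF A1]])
  then have "is_Gin I (monomial_span (leads (act A1 ` I)))"
    unfolding is_Gin_def initial_ideal_eq using U by metis
  then show ?thesis
    using up[OF inv[OF A1]] ar[OF A1] card[OF inv[OF A1]] by blast
qed

theorem theorem2p1p1:
  fixes d1 d2 d3 :: nat
  shows "\<exists>J :: 'k::field_char_0 poly3 set. \<forall>f1 f2 f3.
    f1 \<in> homog d1 \<and> f2 \<in> homog d2 \<and> f3 \<in> homog d3 \<and>
    regular_sequence [f1, f2, f3] \<and> SLP (ideal.span {f1, f2, f3}) \<longrightarrow>
    is_Gin (ideal.span {f1, f2, f3}) J \<and> Gin (ideal.span {f1, f2, f3}) = J \<and> almost_revlex J"
proof -
  define hyp where "hyp = (\<lambda>f1 f2 f3 :: 'k poly3. f1 \<in> homog d1 \<and> f2 \<in> homog d2 \<and> f3 \<in> homog d3 \<and>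
    regular_sequence [f1, f2, f3] \<and> SLP (ideal.span {f1, f2, f3}))"
  define good where "good L \<longleftrightarrow> up_closed L \<and> almost_revlex (monomial_span L :: 'k poly3 set) \<and>
    (\<forall>t. int (card {u. deg u = t}) - int (card {u\<in>L. deg u = t}) = hilb_rec [d3, d2, d1] t)" for L
  have ex: "\<exists>L. good L \<and> is_Gin (ideal.span {f1, f2, f3}) (monomial_span L)" if "hyp f1 f2 f3" for f1 f2 f3
  proof -
    let ?I = "ideal.span {f1, f2, f3}"
    have h: "f1 \<in> homog d1" "f2 \<in> homog d2" "f3 \<in> homog d3" "regular_sequence [f1, f2, f3]" "SLP ?I"
      using that by (simp_all add: hyp_def)
    have I: "graded_ideal ?I"
      using h by (intro graded_ideal_span) auto
    have hilb: "hilb ?I t = hilb_rec [d3, d2, d1] t" for t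
      by (rule hilb_regular_sequence[OF h(1-4)])
    have "homog t \<subseteq> ?I" if "d1 + d2 + d3 \<le> t" for t
      by (rule hilb_zero_imp) (simp, simp only: hilb hilb_rec_zero[OF that])
    from Gin_almost_revlex[OF I h(5) this]
    obtain L where L: "up_closed L" "almost_revlex (monomial_span L :: 'k poly3 set)"
        "is_Gin ?I (monomial_span L)" "\<And>t. card {u\<in>L. deg u = t} = card (leads (part ?I t))"
      by blast
    have "good L"
      unfolding good_def L(4) hilb[symmetric] hilb_def using L(1,2) by blast
    then show ?thesis
      using L(3) by blast
  qed
  \<comment> \<open>The Hilbert function prescribed by the degrees leaves only one possibility.\<close>
  have unique: "L = L'" if "good L" "good L'" for L L'
  proof (rule almost_revlex_unique[where 'k = 'k])
    fix t
    have "int (card {u. deg u = t}) - int (card {u\<in>L. deg u = t})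
        = int (card {u. deg u = t}) - int (card {u\<in>L'. deg u = t})"
      using that unfolding good_def by metis
    then show "card {u\<in>L. deg u = t} = card {u\<in>L'. deg u = t}"
      by simp
  qed (use that in \<open>simp_all add: good_def\<close>)
  define L0 where "L0 = (SOME L. good L)"
  have L0: "L = L0" if "good L" for L
    unfolding L0_def using unique[OF that] someI[of good, OF that] by blast
  have "is_Gin (ideal.span {f1, f2, f3}) (monomial_span L0) \<and>
    Gin (ideal.span {f1, f2, f3}) = monomial_span L0 \<and> almost_revlex (monomial_span L0 :: 'k poly3 set)"
    if hyp: "hyp f1 f2 f3" for f1 f2 f3
  proof -
    obtain L where L: "good L" "is_Gin (ideal.span {f1, f2, f3}) (monomial_span L)"
      using ex[OF hyp] by blast
    have "almost_revlex (monomial_span L :: 'k poly3 set)"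
      using L(1) by (simp add: good_def)
    then show ?thesis
      using L(2) Gin_eqI[OF L(2)] unfolding L0[OF L(1)] by blast
  qed
  then show ?thesis
    unfolding hyp_def by blast
qed

end
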